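(* Let $\mathfrak g$ be a simple finite-dimensional Lie algebra and let $\mathcal W$ be the classical $\mathcal W$-algebra associated to a short nilpotent element $f\in\mathfrak g$. As a differential algebra, $\mathcal W$ is the algebra of differential polynomials with the following generators: $a_i$, for $i\in J_0^f$ (a basis of $\mathfrak g_0^f$), and $\psi(u_k)$, for $k\in J_1$, where $\{u_k\}_{k\in J_1}$ is a basis of $\mathfrak g_{-1}$ and $\psi:\mathfrak g_{-1}\to\mathcal W\{2\}$ is the injective linear map $$\psi(u)=u-\frac12\sum_{k\in J_1}[u,u^k][e,u_k]-\frac18\sum_{k\in J_1}[f,u^k][e,u\circ u_k]+\frac12\partial[e,u].$$ The subspace of elements of conformal weight $1$ is $\mathcal W\{1\}=\mathfrak g_0^f$, and the subspace of elements of conformal weight $2$ is $$\mathcal W\{2\}=\psi(\mathfrak g_{-1})\oplus\partial\mathfrak g_0^f\oplus S^2\mathfrak g_0^f.$$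
   Context: The base field $\mathbb F$ is algebraically closed of characteristic $0$. $\mathfrak g$ carries a non-degenerate symmetric invariant bilinear form $(\cdot|\cdot)$. $\{f,2x,e\}$ is an $\mathfrak{sl}_2$-triple: $[e,f]=2x$, $[x,e]=e$, $[x,f]=-f$; $\mathfrak g_i$ is the $\mathrm{ad}\,x$-eigenspace of eigenvalue $i$. $f$ is short if $\mathfrak g=\mathfrak g_{-1}\oplus\mathfrak g_0\oplus\mathfrak g_1$. $\mathfrak g_0^f$ is the centralizer of $f$ in $\mathfrak g_0$. For $a,b\in\mathfrak g_{-1}$, $a\circ b=[[e,a],b]$. $\{u_k\}_{k\in J_1}$ is a basis of $\mathfrak g_{-1}$ and $\{u^k\}_{k\in J_1}$ is the dual basis of $\mathfrak g_1$ with respect to $(\cdot|\cdot)$. Classical $\mathcal W$-algebra: fix $s\in\mathfrak g_1$. $\mathcal V(\mathfrak g)=S(\mathbb F[\partial]\mathfrak g)$ is the algebra of differential polynomials over $\mathfrak g$, with the Poisson vertex algebra $\lambda$-bracket determined by $\{a_\lambda b\}_z=[a,b]+(a|b)\lambda+z(s|[a,b])$, $a,b\in\mathfrak g$ ($z\in\mathbb F$ or a formal variable), extended by sesquilinearity ($\{\partial g_\lambda h\}=-\lambda\{g_\lambda h\}$, $\{g_\lambda\partial h\}=(\partial+\lambda)\{g_\lambda h\}$) and the Leibniz rules ($\{g_\lambda h_1h_2\}=\{g_\lambda h_1\}h_2+\{g_\lambda h_2\}h_1$, $\{g_1g_{2\,\lambda}h\}=\{g_{1\,\lambda+\partial}h\}_\to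 g_2+\{g_{2\,\lambda+\partial}h\}_\to g_1$, the arrow meaning that $\partial$ acts on the right). $\rho:\mathcal V(\mathfrak g)\to\mathcal V(\mathfrak g_{\le0})=S(\mathbb F[\partial]\mathfrak g_{\le0})$ is the differential algebra homomorphism with $\rho(a)=\pi_{\le0}(a)+(f|a)$, $a\in\mathfrak g$, where $\pi_{\le0}:\mathfrak g\to\mathfrak g_{\le0}=\mathfrak g_{-1}\oplus\mathfrak g_0$ is the projection with kernel $\mathfrak g_1$. $\mathcal W=\{g\in\mathcal V(\mathfrak g_{\le0})\mid\rho\{a_\lambda g\}_z=0\ \forall a\in\mathfrak g_1\}$, a differential subalgebra (independent of $z$ and $s$). Conformal weight: on $\mathcal V(\mathfrak g_{\le0})$ the monomial $b_1^{(m_1)}\cdots b_r^{(m_r)}$ with $b_i\in\mathfrak g_{1-\Delta_i}$ has conformal weight $\sum_i(\Delta_i+m_i)$; $\mathcal W\{\Delta\}$ is the subspace of elements of $\mathcal W$ of conformal weight $\Delta$. *)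

theory Defs
  imports "HOL-Library.Poly_Mapping" "HOL-Computational_Algebra.Polynomial"
begin

locale lie_algebra = vector_space scale
  for scale :: "'k::field \<Rightarrow> 'g::ab_group_add \<Rightarrow> 'g" +
  fixes lie :: "'g \<Rightarrow> 'g \<Rightarrow> 'g"
  assumes lie_add_left: "lie (a + b) c = lie a c + lie b c"
    and lie_add_right: "lie a (b + c) = lie a b + lie a c"
    and lie_scale_left: "lie (scale r a) b = scale r (lie a b)"
    and lie_scale_right: "lie a (scale r b) = scale r (lie a b)"
    and lie_self: "lie a a = 0"
    and jacobi: "lie a (lie b c) + lie b (lie c a) + lie c (lie a b) = 0"

definition is_simple_lie ::
  "('k::field \<Rightarrow> 'g::ab_group_add \<Rightarrow> 'g) \<Rightarrow> ('g \<Rightarrow> 'g \<Rightarrow> 'g) \<Rightarrow> bool" where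
  "is_simple_lie scale lie \<longleftrightarrow>
     (\<exists>a b. lie a b \<noteq> 0) \<and>
     (\<forall>I. module.subspace scale I \<and> (\<forall>a. \<forall>b\<in>I. lie a b \<in> I) \<longrightarrow> I = {0} \<or> I = UNIV)"

definition nondeg_invariant_form ::
  "('k::field \<Rightarrow> 'g::ab_group_add \<Rightarrow> 'g) \<Rightarrow> ('g \<Rightarrow> 'g \<Rightarrow> 'g) \<Rightarrow> ('g \<Rightarrow> 'g \<Rightarrow> 'k) \<Rightarrow> bool" where
  "nondeg_invariant_form scale lie form \<longleftrightarrow>
     (\<forall>a b c. form (a + b) c = form a c + form b c) \<and>
     (\<forall>r a b. form (scale r a) b = r * form a b) \<and>
     (\<forall>a b. form a b = form b a) \<and>
     (\<forall>a b c. form (lie a b) c = form a (lie b c)) \<and>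
     (\<forall>a. (\<forall>b. form a b = 0) \<longrightarrow> a = 0)"

text \<open>The triple is \<open>(f, 2x, e)\<close>.\<close>

definition sl2_triple ::
  "('k::field \<Rightarrow> 'g::ab_group_add \<Rightarrow> 'g) \<Rightarrow> ('g \<Rightarrow> 'g \<Rightarrow> 'g) \<Rightarrow> 'g \<Rightarrow> 'g \<Rightarrow> 'g \<Rightarrow> bool" where
  "sl2_triple scale lie f x e \<longleftrightarrow>
     lie e f = scale 2 x \<and> lie x e = e \<and> lie x f = - f"

definition grade ::
  "('k::field \<Rightarrow> 'g::ab_group_add \<Rightarrow> 'g) \<Rightarrow> ('g \<Rightarrow> 'g \<Rightarrow> 'g) \<Rightarrow> 'g \<Rightarrow> int \<Rightarrow> 'g set" where
  "grade scale lie x i = {a. lie x a = scale (of_int i) a}"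

text \<open>Only spanning is required: the sum is automatically direct in characteristic 0, the summands
  being eigenspaces for distinct eigenvalues.\<close>

definition short_grading ::
  "('k::field \<Rightarrow> 'g::ab_group_add \<Rightarrow> 'g) \<Rightarrow> ('g \<Rightarrow> 'g \<Rightarrow> 'g) \<Rightarrow> 'g \<Rightarrow> bool" where
  "short_grading scale lie x \<longleftrightarrow>
     (\<forall>a. \<exists>b\<in>grade scale lie x (-1). \<exists>c\<in>grade scale lie x 0. \<exists>d\<in>grade scale lie x 1.
        a = b + c + d)"

definition grade_le0 ::
  "('k::field \<Rightarrow> 'g::ab_group_add \<Rightarrow> 'g) \<Rightarrow> ('g \<Rightarrow> 'g \<Rightarrow> 'g) \<Rightarrow> 'g \<Rightarrow> 'g set" where
  "grade_le0 scale lie x = {b + c | b c. b \<in> grade scale lie x (-1) \<and> c \<in> grade scale lie x 0}"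

definition proj_le0 ::
  "('k::field \<Rightarrow> 'g::ab_group_add \<Rightarrow> 'g) \<Rightarrow> ('g \<Rightarrow> 'g \<Rightarrow> 'g) \<Rightarrow> 'g \<Rightarrow> 'g \<Rightarrow> 'g" where
  "proj_le0 scale lie x a = (THE b. b \<in> grade_le0 scale lie x \<and> a - b \<in> grade scale lie x 1)"

definition centralizer0 ::
  "('k::field \<Rightarrow> 'g::ab_group_add \<Rightarrow> 'g) \<Rightarrow> ('g \<Rightarrow> 'g \<Rightarrow> 'g) \<Rightarrow> 'g \<Rightarrow> 'g \<Rightarrow> 'g set" where
  "centralizer0 scale lie x f = {a \<in> grade scale lie x 0. lie f a = 0}"

definition basis_family ::
  "('k::field \<Rightarrow> 'g::ab_group_add \<Rightarrow> 'g) \<Rightarrow> 'j set \<Rightarrow> ('j \<Rightarrow> 'g) \<Rightarrow> 'g set \<Rightarrow> bool" where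
  "basis_family scale J v S \<longleftrightarrow>
     inj_on v J \<and> \<not> module.dependent scale (v ` J) \<and> module.span scale (v ` J) = S"

text \<open>Polynomials over \<open>'k\<close> in the variables \<open>(i, m)\<close>, which stand for the \<open>m\<close>-th derivative of the
  \<open>i\<close>-th differential variable. Monomials are finitely supported exponent functions.\<close>

type_synonym ('i, 'k) dpoly = "(('i \<times> nat) \<Rightarrow>\<^sub>0 nat) \<Rightarrow>\<^sub>0 'k"

definition dp_const :: "'k::field \<Rightarrow> ('i, 'k) dpoly" where
  "dp_const c = Poly_Mapping.single 0 c"

definition dp_var :: "'i \<Rightarrow> nat \<Rightarrow> ('i, 'k::field) dpoly" where
  "dp_var i m = Poly_Mapping.single (Poly_Mapping.single (i, m) 1) 1"

definition dp_scale :: "'k::field \<Rightarrow> ('i, 'k) dpoly \<Rightarrow> ('i, 'k) dpoly" where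
  "dp_scale c p = dp_const c * p"

text \<open>The derivation with \<open>(i, m) \<mapsto> (i, m + 1)\<close>.\<close>

definition dp_deriv :: "('i, 'k::field) dpoly \<Rightarrow> ('i, 'k) dpoly" where
  "dp_deriv p = (\<Sum>m\<in>Poly_Mapping.keys p. \<Sum>v\<in>Poly_Mapping.keys m.
     Poly_Mapping.single
       (m - Poly_Mapping.single v 1 + Poly_Mapping.single (fst v, Suc (snd v)) 1)
       (of_nat (Poly_Mapping.lookup m v) * Poly_Mapping.lookup p m))"

definition dpolys :: "'j set \<Rightarrow> ('j, 'k::field) dpoly set" where
  "dpolys J = {p. \<forall>m\<in>Poly_Mapping.keys p. \<forall>v\<in>Poly_Mapping.keys m. fst v \<in> J}"

text \<open>The differential algebra homomorphism sending the \<open>j\<close>-th differential variable to \<open>w j\<close>.\<close>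

definition dp_eval ::
  "('j \<Rightarrow> ('i, 'k::field) dpoly) \<Rightarrow> ('j, 'k) dpoly \<Rightarrow> ('i, 'k) dpoly" where
  "dp_eval w p = (\<Sum>m\<in>Poly_Mapping.keys p. dp_const (Poly_Mapping.lookup p m) *
     (\<Prod>v\<in>Poly_Mapping.keys m. ((dp_deriv ^^ snd v) (w (fst v))) ^ Poly_Mapping.lookup m v))"

inductive_set diff_subalgebra :: "('i, 'k::field) dpoly set \<Rightarrow> ('i, 'k) dpoly set"
  for S :: "('i, 'k) dpoly set" where
  gen: "p \<in> S \<Longrightarrow> p \<in> diff_subalgebra S"
| const: "dp_const c \<in> diff_subalgebra S"
| add: "p \<in> diff_subalgebra S \<Longrightarrow> q \<in> diff_subalgebra S \<Longrightarrow> p + q \<in> diff_subalgebra S"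
| mult: "p \<in> diff_subalgebra S \<Longrightarrow> q \<in> diff_subalgebra S \<Longrightarrow> p * q \<in> diff_subalgebra S"
| deriv: "p \<in> diff_subalgebra S \<Longrightarrow> dp_deriv p \<in> diff_subalgebra S"

text \<open>Injectivity says that the elements \<open>(dp_deriv ^^ m) (w j)\<close> are algebraically independent,
  surjectivity that they generate \<open>A\<close>.\<close>

definition is_diff_poly_algebra_on ::
  "'j set \<Rightarrow> ('j \<Rightarrow> ('i, 'k::field) dpoly) \<Rightarrow> ('i, 'k) dpoly set \<Rightarrow> bool" where
  "is_diff_poly_algebra_on J w A \<longleftrightarrow> bij_betw (dp_eval w) (dpolys J) A"

text \<open>\<open>V(g)\<close> is the whole type \<open>('i, 'k) dpoly\<close>, where \<open>bas :: 'i \<Rightarrow> 'g\<close> is a basis of \<open>g\<close>; this is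
  the embedding of \<open>g\<close> into it. The basis need not be compatible with the grading.\<close>

definition emb ::
  "('k::field \<Rightarrow> 'g::ab_group_add \<Rightarrow> 'g) \<Rightarrow> ('i::finite \<Rightarrow> 'g) \<Rightarrow> 'g \<Rightarrow> ('i, 'k) dpoly" where
  "emb scale bas a =
     (\<Sum>i\<in>UNIV. dp_scale (module.representation scale (range bas) a (bas i)) (dp_var i 0))"

definition V_le0 ::
  "('k::field \<Rightarrow> 'g::ab_group_add \<Rightarrow> 'g) \<Rightarrow> ('g \<Rightarrow> 'g \<Rightarrow> 'g) \<Rightarrow> ('i::finite \<Rightarrow> 'g) \<Rightarrow> 'g
    \<Rightarrow> ('i, 'k) dpoly set" where
  "V_le0 scale lie bas x = diff_subalgebra (emb scale bas ` grade_le0 scale lie x)"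

text \<open>The bracket takes values in polynomials in \<open>\<lambda>\<close> with coefficients in \<open>V(g)\<close>. The first operator
  is \<open>\<partial> + \<lambda>\<close>; for \<open>P = \<Sum>\<^sub>n c\<^sub>n \<lambda>\<^sup>n\<close>, the second is \<open>P(\<lambda> + \<partial>)\<^sub>\<rightarrow> h = \<Sum>\<^sub>n c\<^sub>n (\<lambda> + \<partial>)\<^sup>n h\<close>.\<close>

definition lam_deriv :: "('i, 'k::field) dpoly poly \<Rightarrow> ('i, 'k) dpoly poly" where
  "lam_deriv P = map_poly dp_deriv P + pCons 0 P"

definition arrow_apply ::
  "('i, 'k::field) dpoly poly \<Rightarrow> ('i, 'k) dpoly \<Rightarrow> ('i, 'k) dpoly poly" where
  "arrow_apply P h = (\<Sum>n\<le>degree P. smult (coeff P n) ((lam_deriv ^^ n) [:h:]))"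

text \<open>Bilinearity, sesquilinearity, the two Leibniz rules and the values on \<open>g\<close>. These determine the
  bracket uniquely, and it exists (it is given by the master formula).\<close>

definition affine_lambda_bracket ::
  "('k::field \<Rightarrow> 'g::ab_group_add \<Rightarrow> 'g) \<Rightarrow> ('g \<Rightarrow> 'g \<Rightarrow> 'g) \<Rightarrow> ('g \<Rightarrow> 'g \<Rightarrow> 'k) \<Rightarrow>
   ('i::finite \<Rightarrow> 'g) \<Rightarrow> 'g \<Rightarrow> 'k \<Rightarrow>
   (('i, 'k) dpoly \<Rightarrow> ('i, 'k) dpoly \<Rightarrow> ('i, 'k) dpoly poly) \<Rightarrow> bool" where
  "affine_lambda_bracket scale lie form bas s z br \<longleftrightarrow>
     (\<forall>g g' h. br (g + g') h = br g h + br g' h) \<and>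
     (\<forall>g h h'. br g (h + h') = br g h + br g h') \<and>
     (\<forall>c g h. br (dp_scale c g) h = smult (dp_const c) (br g h)) \<and>
     (\<forall>c g h. br g (dp_scale c h) = smult (dp_const c) (br g h)) \<and>
     (\<forall>g h. br (dp_deriv g) h = - pCons 0 (br g h)) \<and>
     (\<forall>g h. br g (dp_deriv h) = lam_deriv (br g h)) \<and>
     (\<forall>g h1 h2. br g (h1 * h2) = smult h2 (br g h1) + smult h1 (br g h2)) \<and>
     (\<forall>g1 g2 h. br (g1 * g2) h = arrow_apply (br g1 h) g2 + arrow_apply (br g2 h) g1) \<and>
     (\<forall>a b. br (emb scale bas a) (emb scale bas b) =
        [: emb scale bas (lie a b) + dp_const (z * form s (lie a b)), dp_const (form a b) :])"

definition rho ::
  "('k::field \<Rightarrow> 'g::ab_group_add \<Rightarrow> 'g) \<Rightarrow> ('g \<Rightarrow> 'g \<Rightarrow> 'g) \<Rightarrow> ('g \<Rightarrow> 'g \<Rightarrow> 'k) \<Rightarrow>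
   ('i::finite \<Rightarrow> 'g) \<Rightarrow> 'g \<Rightarrow> 'g \<Rightarrow> ('i, 'k) dpoly \<Rightarrow> ('i, 'k) dpoly" where
  "rho scale lie form bas x f =
     dp_eval (\<lambda>i. emb scale bas (proj_le0 scale lie x (bas i)) + dp_const (form f (bas i)))"

definition W_alg ::
  "('k::field \<Rightarrow> 'g::ab_group_add \<Rightarrow> 'g) \<Rightarrow> ('g \<Rightarrow> 'g \<Rightarrow> 'g) \<Rightarrow> ('g \<Rightarrow> 'g \<Rightarrow> 'k) \<Rightarrow>
   ('i::finite \<Rightarrow> 'g) \<Rightarrow> 'g \<Rightarrow> 'g \<Rightarrow>
   (('i, 'k) dpoly \<Rightarrow> ('i, 'k) dpoly \<Rightarrow> ('i, 'k) dpoly poly) \<Rightarrow> ('i, 'k) dpoly set" where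
  "W_alg scale lie form bas x f br =
     {g \<in> V_le0 scale lie bas x.
        \<forall>a\<in>grade scale lie x 1. map_poly (rho scale lie form bas x f) (br (emb scale bas a) g) = 0}"

text \<open>A list entry \<open>(b, d, m)\<close> contributes the factor \<open>b\<^sup>(\<^sup>m\<^sup>)\<close> with \<open>b\<close> of degree \<open>1 - d\<close>, hence of weight
  \<open>d + m\<close>. As \<open>g\<^sub>\<le>\<^sub>0\<close> has degrees \<open>-1\<close> and \<open>0\<close>, only \<open>d = 1, 2\<close> occur.\<close>

definition V_weight ::
  "('k::field \<Rightarrow> 'g::ab_group_add \<Rightarrow> 'g) \<Rightarrow> ('g \<Rightarrow> 'g \<Rightarrow> 'g) \<Rightarrow> ('i::finite \<Rightarrow> 'g) \<Rightarrow> 'g \<Rightarrow> nat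
    \<Rightarrow> ('i, 'k) dpoly set" where
  "V_weight scale lie bas x D = module.span dp_scale
     {prod_list (map (\<lambda>(b, d, m). (dp_deriv ^^ m) (emb scale bas b)) l) | l.
        (\<forall>(b, d, m)\<in>set l. d \<in> {1, 2} \<and> b \<in> grade scale lie x (1 - int d)) \<and>
        sum_list (map (\<lambda>(b, d, m). d + m) l) = D}"

definition W_weight ::
  "('k::field \<Rightarrow> 'g::ab_group_add \<Rightarrow> 'g) \<Rightarrow> ('g \<Rightarrow> 'g \<Rightarrow> 'g) \<Rightarrow> ('g \<Rightarrow> 'g \<Rightarrow> 'k) \<Rightarrow>
   ('i::finite \<Rightarrow> 'g) \<Rightarrow> 'g \<Rightarrow> 'g \<Rightarrow>
   (('i, 'k) dpoly \<Rightarrow> ('i, 'k) dpoly \<Rightarrow> ('i, 'k) dpoly poly) \<Rightarrow> nat \<Rightarrow> ('i, 'k) dpoly set" where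
  "W_weight scale lie form bas x f br D =
     W_alg scale lie form bas x f br \<inter> V_weight scale lie bas x D"

definition circ :: "('g \<Rightarrow> 'g \<Rightarrow> 'g) \<Rightarrow> 'g \<Rightarrow> 'g \<Rightarrow> 'g \<Rightarrow> 'g" where
  "circ lie e a b = lie (lie e a) b"

definition psi ::
  "('k::field \<Rightarrow> 'g::ab_group_add \<Rightarrow> 'g) \<Rightarrow> ('g \<Rightarrow> 'g \<Rightarrow> 'g) \<Rightarrow> ('i::finite \<Rightarrow> 'g) \<Rightarrow> 'g \<Rightarrow> 'g \<Rightarrow>
   'j set \<Rightarrow> ('j \<Rightarrow> 'g) \<Rightarrow> ('j \<Rightarrow> 'g) \<Rightarrow> 'g \<Rightarrow> ('i, 'k) dpoly" where
  "psi scale lie bas e f J u u' v =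
     emb scale bas v
     - dp_scale (1/2) (\<Sum>k\<in>J. emb scale bas (lie v (u' k)) * emb scale bas (lie e (u k)))
     - dp_scale (1/8) (\<Sum>k\<in>J. emb scale bas (lie f (u' k)) * emb scale bas (lie e (circ lie e v (u k))))
     + dp_scale (1/2) (dp_deriv (emb scale bas (lie e v)))"

definition sym2 ::
  "('k::field \<Rightarrow> 'g::ab_group_add \<Rightarrow> 'g) \<Rightarrow> ('i::finite \<Rightarrow> 'g) \<Rightarrow> 'g set \<Rightarrow> ('i, 'k) dpoly set" where
  "sym2 scale bas U =
     module.span dp_scale {emb scale bas a * emb scale bas b | a b. a \<in> U \<and> b \<in> U}"

definition is_direct_sum3 :: "'v::ab_group_add set \<Rightarrow> 'v set \<Rightarrow> 'v set \<Rightarrow> 'v set \<Rightarrow> bool" where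
  "is_direct_sum3 S A B C \<longleftrightarrow>
     S = {p + q + r | p q r. p \<in> A \<and> q \<in> B \<and> r \<in> C} \<and>
     (\<forall>p\<in>A. \<forall>q\<in>B. \<forall>r\<in>C. p + q + r = 0 \<longrightarrow> p = 0 \<and> q = 0 \<and> r = 0)"

end

theory Submission
  imports Defs
begin

text \<open>
  For \<open>c \<in> g\<^sub>1\<close> the map \<open>D\<^sub>c = \<rho>{c\<^sub>\<lambda> \<cdot>}\<close> is a derivation on \<open>V(g\<^sub>\<le>\<^sub>0)\<close> that intertwines \<open>\<partial>\<close> with \<open>\<partial> + \<lambda>\<close>, with
  \<open>D\<^sub>c b = (c | [b, f])\<close> on \<open>g\<^sub>0\<close> and \<open>D\<^sub>c v = [c, v] + (c | v) \<lambda>\<close> on \<open>g\<^sub>-\<^sub>1\<close>. From \<open>[f, [e, v]] = 2v\<close> one gets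
  \<open>g\<^sub>0 = g\<^sub>0\<^sup>f \<oplus> [e, g\<^sub>-\<^sub>1]\<close>, and \<open>D\<^sub>c \<psi>(v) = 0\<close> is a computation with dual bases. Hence \<open>V(g\<^sub>\<le>\<^sub>0)\<close> is the algebra of
  differential polynomials in the \<open>a\<^sub>i\<close>, the \<open>\<psi>(u\<^sub>k)\<close> and \<open>h\<^sub>k = [e, u\<^sub>k]\<close>; the first two kinds are annihilated by all
  \<open>D\<^sub>c\<close>, while \<open>D\<close> of \<open>h\<^sub>j\<close> at \<open>c = u\<^sup>k\<close> is \<open>-2\<delta>\<^sub>j\<^sub>k\<close>, so \<open>W\<close> consists of the elements not involving the \<open>h\<^sub>k\<close>.
\<close>

section \<open>Differential polynomials\<close>

lemma poly_mapping_sum_singles: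
  fixes p :: "'a \<Rightarrow>\<^sub>0 'b::comm_monoid_add"
  shows "(\<Sum>m\<in>Poly_Mapping.keys p. Poly_Mapping.single m (Poly_Mapping.lookup p m)) = p"
proof (rule poly_mapping_eqI)
  fix k
  show "Poly_Mapping.lookup (\<Sum>m\<in>Poly_Mapping.keys p. Poly_Mapping.single m (Poly_Mapping.lookup p m)) k
      = Poly_Mapping.lookup p k"
    by (simp add: lookup_sum lookup_single when_def in_keys_iff)
qed

lemma poly_mapping_induct_single [case_names zero single add]:
  fixes p :: "'a \<Rightarrow>\<^sub>0 'b::comm_monoid_add"
  assumes "P 0" and "\<And>m c. P (Poly_Mapping.single m c)" and "\<And>p q. P p \<Longrightarrow> P q \<Longrightarrow> P (p + q)"
  shows "P p"
proof -
  have "P (\<Sum>m\<in>A. Poly_Mapping.single m (Poly_Mapping.lookup p m))" if "finite A" for A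
    using that by (induction A rule: finite_induct) (auto intro: assms)
  from this[of "Poly_Mapping.keys p"] show ?thesis by (simp add: poly_mapping_sum_singles)
qed


text \<open>Both \<open>dp_deriv\<close> and \<open>dp_eval\<close> are linear extensions of a map
  on monomials; their product rules reduce to rules for adding exponents.\<close>

definition lin_ext :: "((('i \<times> nat) \<Rightarrow>\<^sub>0 nat) \<Rightarrow> ('j, 'k::field) dpoly) \<Rightarrow> ('i, 'k) dpoly \<Rightarrow> ('j, 'k) dpoly" where
  "lin_ext \<phi> p = (\<Sum>m\<in>Poly_Mapping.keys p. dp_const (Poly_Mapping.lookup p m) * \<phi> m)"

lemma dp_const_0 [simp]: "dp_const 0 = 0"
  and dp_const_1 [simp]: "dp_const 1 = 1"
  and dp_const_add: "dp_const (a + b) = dp_const a + dp_const b"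
  and dp_const_mult: "dp_const (a * b) = dp_const a * dp_const b"
  and dp_const_uminus: "dp_const (- a) = - dp_const a"
  by (simp_all add: dp_const_def single_add mult_single single_uminus)

lemma dp_const_of_nat: "dp_const (of_nat n) = of_nat n"
  by (induction n) (simp_all add: dp_const_add)

lemma dp_const_numeral [simp]: "dp_const (numeral n) = numeral n"
  using dp_const_of_nat[of "numeral n"] by simp

lemma dp_const_eq_iff [simp]: "dp_const a = dp_const b \<longleftrightarrow> a = b"
  unfolding dp_const_def by (metis lookup_single_eq)

lemma dp_const_eq_0_iff [simp]: "dp_const a = 0 \<longleftrightarrow> a = 0"
  using dp_const_eq_iff[of a 0] by (simp del: dp_const_eq_iff)

lemma lin_ext_0 [simp]: "lin_ext \<phi> 0 = 0"
  by (simp add: lin_ext_def)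

lemma lin_ext_single [simp]: "lin_ext \<phi> (Poly_Mapping.single m c) = dp_const c * \<phi> m"
  by (cases "c = 0") (simp_all add: lin_ext_def)

lemma lin_ext_add: "lin_ext \<phi> (p + q) = lin_ext \<phi> p + lin_ext \<phi> q"
  unfolding lin_ext_def
  by (rule setsum_keys_plus_distrib) (simp_all add: dp_const_add distrib_right)

lemma lin_ext_mult:
  assumes "\<And>m n. \<phi> (m + n) = \<phi> m * \<phi> n"
  shows "lin_ext \<phi> (p * q) = lin_ext \<phi> p * lin_ext \<phi> q"
proof (induction p rule: poly_mapping_induct_single)
  case (single m c)
  show ?case
    by (induction q rule: poly_mapping_induct_single)
      (simp_all add: mult_single assms dp_const_mult distrib_left lin_ext_add)
qed (simp_all add: lin_ext_add distrib_right)

lemma lin_ext_leibniz: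
  assumes "\<And>m n. \<phi> (m + n) = Poly_Mapping.single m 1 * \<phi> n + Poly_Mapping.single n 1 * \<phi> m"
  shows "lin_ext \<phi> (p * q) = p * lin_ext \<phi> q + q * lin_ext \<phi> p"
proof (induction p rule: poly_mapping_induct_single)
  case (single m c)
  show ?case
  proof (induction q rule: poly_mapping_induct_single)
    case (single n d)
    have s: "Poly_Mapping.single m c = dp_const c * Poly_Mapping.single m 1"
      "Poly_Mapping.single n d = dp_const d * Poly_Mapping.single n 1"
      by (simp_all add: dp_const_def mult_single)
    have "lin_ext \<phi> (Poly_Mapping.single m c * Poly_Mapping.single n d)
        = dp_const c * dp_const d * (Poly_Mapping.single m 1 * \<phi> n
          + Poly_Mapping.single n 1 * \<phi> m)"
      by (simp add: mult_single assms dp_const_mult)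
    then show ?case by (simp add: s[symmetric]) (simp add: s algebra_simps)
  qed (simp_all add: distrib_left lin_ext_add algebra_simps)
qed (simp_all add: lin_ext_add algebra_simps)

section \<open>The derivation of differential polynomials\<close>

definition deriv_monom :: "(('i \<times> nat) \<Rightarrow>\<^sub>0 nat) \<Rightarrow> ('i, 'k::field) dpoly" where
  "deriv_monom m = (\<Sum>v\<in>Poly_Mapping.keys m. Poly_Mapping.single
       (m - Poly_Mapping.single v 1 + Poly_Mapping.single (fst v, Suc (snd v)) 1)
       (of_nat (Poly_Mapping.lookup m v)))"

lemma dp_deriv_eq_lin_ext: "dp_deriv = lin_ext deriv_monom"
  by (simp add: fun_eq_iff dp_deriv_def lin_ext_def deriv_monom_def sum_distrib_left dp_const_def
      mult_single mult.commute)

text \<open>Enlarging the index set adds only terms with exponent 0, so monomials with different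
  supports can be compared over one common set.\<close>

lemma deriv_monom_superset:
  assumes "finite A" "Poly_Mapping.keys m \<subseteq> A"
  shows "deriv_monom m = (\<Sum>v\<in>A. Poly_Mapping.single
       (m - Poly_Mapping.single v 1 + Poly_Mapping.single (fst v, Suc (snd v)) 1)
       (of_nat (Poly_Mapping.lookup m v)))"
  unfolding deriv_monom_def
  by (rule sum.mono_neutral_left) (use assms in \<open>auto simp: in_keys_iff\<close>)

lemma deriv_monom_add:
  "deriv_monom (m + n) = Poly_Mapping.single m 1 * deriv_monom n + Poly_Mapping.single n 1 * deriv_monom m"
proof -
  let ?A = "Poly_Mapping.keys m \<union> Poly_Mapping.keys n"
  \<comment> \<open>Subtraction of exponents is truncated, so pulling out \<open>m\<close> is
    legitimate only if \<open>v\<close> occurs in \<open>n\<close>; otherwise the coefficient is 0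
    and both sides vanish.\<close>
  have shift: "Poly_Mapping.single (m + n - Poly_Mapping.single v 1 + w) (of_nat (Poly_Mapping.lookup n v))
      = Poly_Mapping.single m 1 * Poly_Mapping.single (n - Poly_Mapping.single v 1 + w) (of_nat (Poly_Mapping.lookup n v))"
    for m n :: "('i \<times> nat) \<Rightarrow>\<^sub>0 nat" and v w
  proof (cases "Poly_Mapping.lookup n v = 0")
    case False
    have "m + n - Poly_Mapping.single v 1 + w = m + (n - Poly_Mapping.single v 1 + w)"
      by (rule poly_mapping_eqI) (use False in \<open>auto simp: lookup_add lookup_minus lookup_single when_def\<close>)
    then show ?thesis by (simp add: mult_single)
  qed simp
  have "deriv_monom (m + n) = (\<Sum>v\<in>?A.
      Poly_Mapping.single (m + n - Poly_Mapping.single v 1 + Poly_Mapping.single (fst v, Suc (snd v)) 1)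
        (of_nat (Poly_Mapping.lookup (m + n) v)))"
    by (rule deriv_monom_superset) (use keys_add[of m n] in auto)
  also have "\<dots> = (\<Sum>v\<in>?A.
      Poly_Mapping.single m 1 * Poly_Mapping.single (n - Poly_Mapping.single v 1 + Poly_Mapping.single (fst v, Suc (snd v)) 1)
        (of_nat (Poly_Mapping.lookup n v))
      + Poly_Mapping.single n 1 * Poly_Mapping.single (m - Poly_Mapping.single v 1 + Poly_Mapping.single (fst v, Suc (snd v)) 1)
        (of_nat (Poly_Mapping.lookup m v)))"
    by (intro sum.cong refl, simp only: lookup_add of_nat_add single_add shift[of m n]
        shift[of n m, unfolded add.commute[of n m]]) (rule add.commute)
  also have "\<dots> = Poly_Mapping.single m 1 * deriv_monom n + Poly_Mapping.single n 1 * deriv_monom m"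
    by (simp add: sum.distrib sum_distrib_left deriv_monom_superset[of ?A])
  finally show ?thesis .
qed

lemma dp_deriv_0 [simp]: "dp_deriv 0 = 0"
  by (simp add: dp_deriv_eq_lin_ext)

lemma dp_deriv_add: "dp_deriv (p + q) = dp_deriv p + dp_deriv q"
  by (simp add: dp_deriv_eq_lin_ext lin_ext_add)

lemma dp_deriv_diff: "dp_deriv (p - q) = dp_deriv p - dp_deriv q"
  using dp_deriv_add[of "p - q" q] by simp

lemma dp_deriv_mult: "dp_deriv (p * q) = p * dp_deriv q + q * dp_deriv p"
  unfolding dp_deriv_eq_lin_ext by (intro lin_ext_leibniz deriv_monom_add)

lemma dp_deriv_const [simp]: "dp_deriv (dp_const c) = 0"
  by (simp add: dp_deriv_eq_lin_ext dp_const_def deriv_monom_def)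

lemma dp_deriv_const_mult: "dp_deriv (dp_const c * p) = dp_const c * dp_deriv p"
  by (simp add: dp_deriv_mult)

lemma dp_deriv_sum: "dp_deriv (sum f A) = (\<Sum>x\<in>A. dp_deriv (f x))"
  by (induction A rule: infinite_finite_induct) (simp_all add: dp_deriv_add)

lemma dp_deriv_var: "dp_deriv (dp_var i m) = dp_var i (Suc m)"
  by (simp add: dp_deriv_eq_lin_ext dp_var_def deriv_monom_def)

lemma dp_deriv_iter_var: "(dp_deriv ^^ n) (dp_var i 0) = dp_var i n"
  by (induction n) (simp_all add: dp_deriv_var)

section \<open>Evaluation as a homomorphism of differential algebras\<close>

definition eval_monom :: "('j \<Rightarrow> ('i, 'k::field) dpoly) \<Rightarrow> (('j \<times> nat) \<Rightarrow>\<^sub>0 nat) \<Rightarrow> ('i, 'k) dpoly" where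
  "eval_monom w m = (\<Prod>v\<in>Poly_Mapping.keys m. ((dp_deriv ^^ snd v) (w (fst v))) ^ Poly_Mapping.lookup m v)"

lemma dp_eval_eq_lin_ext: "dp_eval w = lin_ext (eval_monom w)"
  by (simp add: fun_eq_iff dp_eval_def lin_ext_def eval_monom_def)

lemma eval_monom_superset:
  assumes "finite A" "Poly_Mapping.keys m \<subseteq> A"
  shows "eval_monom w m = (\<Prod>v\<in>A. ((dp_deriv ^^ snd v) (w (fst v))) ^ Poly_Mapping.lookup m v)"
  unfolding eval_monom_def
  by (rule prod.mono_neutral_left) (use assms in \<open>auto simp: in_keys_iff\<close>)

lemma eval_monom_add: "eval_monom w (m + n) = eval_monom w m * eval_monom w n"
proof -
  let ?A = "Poly_Mapping.keys m \<union> Poly_Mapping.keys n"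
  have "eval_monom w (m + n) = (\<Prod>v\<in>?A. ((dp_deriv ^^ snd v) (w (fst v))) ^ Poly_Mapping.lookup (m + n) v)"
    by (rule eval_monom_superset) (use keys_add[of m n] in auto)
  also have "\<dots> = eval_monom w m * eval_monom w n"
    by (simp add: lookup_add power_add prod.distrib eval_monom_superset[of ?A])
  finally show ?thesis .
qed

lemma dp_eval_0 [simp]: "dp_eval w 0 = 0"
  by (simp add: dp_eval_eq_lin_ext)

lemma dp_eval_add: "dp_eval w (p + q) = dp_eval w p + dp_eval w q"
  by (simp add: dp_eval_eq_lin_ext lin_ext_add)

lemma dp_eval_mult: "dp_eval w (p * q) = dp_eval w p * dp_eval w q"
  unfolding dp_eval_eq_lin_ext by (intro lin_ext_mult eval_monom_add)

lemma dp_eval_const [simp]: "dp_eval w (dp_const c) = dp_const c"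
  by (simp add: dp_eval_eq_lin_ext) (simp add: dp_const_def eval_monom_def)

lemma dp_eval_uminus: "dp_eval w (- p) = - dp_eval w p"
  using dp_eval_add[of w p "- p"] by (simp add: eq_neg_iff_add_eq_0 add.commute)

lemma dp_eval_diff: "dp_eval w (p - q) = dp_eval w p - dp_eval w q"
  using dp_eval_add[of w p "- q"] by (simp add: dp_eval_uminus)

lemma dp_eval_sum: "dp_eval w (sum f A) = (\<Sum>x\<in>A. dp_eval w (f x))"
  by (induction A rule: infinite_finite_induct) (simp_all add: dp_eval_add)

lemma dp_eval_var: "dp_eval w (dp_var i m) = (dp_deriv ^^ m) (w i)"
  by (simp add: dp_eval_eq_lin_ext dp_var_def eval_monom_def)

lemma single_eq_prod_vars:
  "Poly_Mapping.single m c = dp_const c * (\<Prod>v\<in>Poly_Mapping.keys m. dp_var (fst v) (snd v) ^ Poly_Mapping.lookup m v)"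
proof -
  have pow: "dp_var i n ^ l = (Poly_Mapping.single (Poly_Mapping.single (i, n) l) 1 :: ('a, 'b) dpoly)" for i n l
    by (induction l) (simp_all add: dp_var_def mult_single single_add[symmetric])
  have prd: "(\<Prod>v\<in>A. Poly_Mapping.single (g v) 1 :: ('a, 'b) dpoly) = Poly_Mapping.single (sum g A) 1" for g and A :: "('a \<times> nat) set"
    by (induction A rule: infinite_finite_induct) (simp_all add: mult_single)
  show ?thesis
    by (simp add: pow prd poly_mapping_sum_singles) (simp add: dp_const_def mult_single)
qed

text \<open>Each monomial is a product of the variables in its support, so constants and the
  variables indexed by \<open>J\<close> generate \<open>dpolys J\<close>. Claims about homomorphisms
  thereby reduce to variables.\<close>

lemma dpolys_induct [consumes 1, case_names const var add mult]:
  assumes "p \<in> dpolys J"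
    and const: "\<And>c. P (dp_const c)" and var: "\<And>i m. i \<in> J \<Longrightarrow> P (dp_var i m)"
    and add: "\<And>p q. P p \<Longrightarrow> P q \<Longrightarrow> P (p + q)" and mult: "\<And>p q. P p \<Longrightarrow> P q \<Longrightarrow> P (p * q)"
  shows "P p"
proof -
  have one: "P 1" and zero: "P 0" using const[of 1] const[of 0] by simp_all
  have pow: "P (q ^ n)" if "P q" for q n by (induction n) (auto intro: one mult that)
  have prd: "P (prod g A)" if "\<And>v. v \<in> A \<Longrightarrow> P (g v)" for g and A :: "('a \<times> nat) set"
    using that by (induction A rule: infinite_finite_induct) (auto intro: one mult)
  have mono: "P (Poly_Mapping.single m c)" if "\<forall>v\<in>Poly_Mapping.keys m. fst v \<in> J" for m c
    unfolding single_eq_prod_vars by (intro mult const prd pow var) (use that in auto)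
  have "P (sum g A)" if "\<And>m. m \<in> A \<Longrightarrow> P (g m)" for g and A :: "('a \<times> nat \<Rightarrow>\<^sub>0 nat) set"
    using that by (induction A rule: infinite_finite_induct) (auto intro: zero add)
  from this[of "Poly_Mapping.keys p" "\<lambda>m. Poly_Mapping.single m (Poly_Mapping.lookup p m)"] show ?thesis
    using assms(1) mono by (simp add: poly_mapping_sum_singles dpolys_def)
qed

lemma dpolys_UNIV: "dpolys UNIV = UNIV"
  by (simp add: dpolys_def)

text \<open>Both sides obey the same sum and product rules, and on a variable the evaluation already
  takes the derivative of the right order.\<close>

lemma dp_eval_deriv: "dp_eval w (dp_deriv p) = dp_deriv (dp_eval w p)"
proof -
  have "p \<in> dpolys UNIV" by (simp add: dpolys_UNIV)
  then show ?thesis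
    by (induction rule: dpolys_induct)
      (simp_all add: dp_deriv_add dp_eval_add dp_deriv_mult dp_eval_mult dp_deriv_var dp_eval_var)
qed

lemma dpolys_const: "dp_const c \<in> dpolys J"
  by (simp add: dpolys_def dp_const_def)

lemma dpolys_var: "i \<in> J \<Longrightarrow> dp_var i m \<in> dpolys J"
  by (simp add: dpolys_def dp_var_def)

lemma dpolys_add: "p \<in> dpolys J \<Longrightarrow> q \<in> dpolys J \<Longrightarrow> p + q \<in> dpolys J"
  using keys_add[of p q] by (auto simp: dpolys_def)

lemma dpolys_mult:
  assumes "p \<in> dpolys J" "q \<in> dpolys J"
  shows "p * q \<in> dpolys J"
  unfolding dpolys_def
proof safe
  fix m i n assume "m \<in> Poly_Mapping.keys (p * q)" and v: "(i, n) \<in> Poly_Mapping.keys m"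
  then obtain a b where "m = a + b" "a \<in> Poly_Mapping.keys p" "b \<in> Poly_Mapping.keys q"
    using keys_mult[of p q] by blast
  then show "fst (i, n) \<in> J" using keys_add[of a b] v assms unfolding dpolys_def by blast
qed

lemma dpolys_deriv: "p \<in> dpolys J \<Longrightarrow> dp_deriv p \<in> dpolys J"
proof -
  assume "p \<in> dpolys J"
  \<comment> \<open>The Leibniz rule for \<open>p * q\<close> contains \<open>p\<close> and
    \<open>q\<close> themselves, so their membership is carried through the induction.\<close>
  then have "p \<in> dpolys J \<and> dp_deriv p \<in> dpolys J"
  proof (induction rule: dpolys_induct)
    case (const c)
    show ?case by (simp add: dpolys_const) (simp add: dpolys_def)
  qed (simp_all add: dp_deriv_add dpolys_add dp_deriv_var dpolys_var dp_deriv_mult dpolys_mult)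
  then show ?thesis ..
qed

section \<open>Polynomials in \<open>\<lambda>\<close>\<close>

lemma coeff_lam_deriv:
  "coeff (lam_deriv P) n = dp_deriv (coeff P n) + (case n of 0 \<Rightarrow> 0 | Suc m \<Rightarrow> coeff P m)"
  by (simp add: lam_deriv_def coeff_map_poly coeff_pCons)

lemma lam_deriv_constant: "lam_deriv [:p:] = [:dp_deriv p, p:]"
  by (rule poly_eqI) (auto simp: coeff_lam_deriv coeff_pCons split: nat.split)

lemma map_poly_lam_deriv:
  assumes "h 0 = 0" "\<And>p q. h (p + q) = h p + h q" "\<And>p. h (dp_deriv p) = dp_deriv (h p)"
  shows "map_poly h (lam_deriv P) = lam_deriv (map_poly h P)"
  by (rule poly_eqI) (simp add: coeff_map_poly coeff_lam_deriv assms split: nat.split)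

text \<open>The substitution of \<partial>, acting on \<open>h\<close>, for \<lambda>:
  \<open>P\<close> becomes a differential operator applied to \<open>h\<close>. This is the value of
  \<open>arrow_apply P h\<close> at \<lambda> = 0.\<close>

definition apply_deriv :: "('i, 'k::field) dpoly \<Rightarrow> ('i, 'k) dpoly poly \<Rightarrow> ('i, 'k) dpoly" where
  "apply_deriv h P = (\<Sum>m\<le>degree P. coeff P m * (dp_deriv ^^ m) h)"

lemma apply_deriv_upto:
  assumes "degree P \<le> n"
  shows "apply_deriv h P = (\<Sum>m\<le>n. coeff P m * (dp_deriv ^^ m) h)"
  unfolding apply_deriv_def
  by (rule sum.mono_neutral_left) (use assms in \<open>auto simp: not_le coeff_eq_0\<close>)

lemma apply_deriv_0 [simp]: "apply_deriv h 0 = 0"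
  by (simp add: apply_deriv_def)

lemma apply_deriv_constant [simp]: "apply_deriv h [:p:] = p * h"
  by (simp add: apply_deriv_def)

lemma apply_deriv_add: "apply_deriv h (P + Q) = apply_deriv h P + apply_deriv h Q"
proof -
  let ?n = "max (degree P) (degree Q)"
  show ?thesis
    by (simp add: apply_deriv_upto[of _ ?n] degree_add_le_max sum.distrib distrib_right)
qed

lemma apply_deriv_smult: "apply_deriv h (smult p P) = p * apply_deriv h P"
  unfolding apply_deriv_upto[OF degree_smult_le] by (simp add: apply_deriv_def sum_distrib_left mult.assoc)

text \<open>By the product rule \<partial>(c \<partial>^m h) = (\<partial>c) \<partial>^m h + c
  \<partial>^(m+1) h, and the second term is the shift caused by multiplication with
  \<lambda>.\<close>

lemma apply_deriv_lam_deriv: "apply_deriv h (lam_deriv P) = dp_deriv (apply_deriv h P)"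
proof -
  let ?n = "degree P"
  have le: "degree (lam_deriv P) \<le> Suc ?n"
    by (rule degree_le) (auto simp: coeff_lam_deriv coeff_eq_0 split: nat.split)
  have "apply_deriv h (lam_deriv P)
      = (\<Sum>m\<le>Suc ?n. dp_deriv (coeff P m) * (dp_deriv ^^ m) h)
        + (\<Sum>m\<le>Suc ?n. (case m of 0 \<Rightarrow> 0 | Suc k \<Rightarrow> coeff P k) * (dp_deriv ^^ m) h)"
    unfolding apply_deriv_upto[OF le] by (simp only: coeff_lam_deriv distrib_right sum.distrib)
  also have "(\<Sum>m\<le>Suc ?n. dp_deriv (coeff P m) * (dp_deriv ^^ m) h)
      = (\<Sum>m\<le>?n. dp_deriv (coeff P m) * (dp_deriv ^^ m) h)"
    by (simp add: coeff_eq_0)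
  also have "(\<Sum>m\<le>Suc ?n. (case m of 0 \<Rightarrow> 0 | Suc k \<Rightarrow> coeff P k) * (dp_deriv ^^ m) h)
      = (\<Sum>m\<le>?n. coeff P m * (dp_deriv ^^ Suc m) h)"
    by (simp add: sum.atMost_Suc_shift del: sum.atMost_Suc)
  finally show ?thesis
    by (simp add: apply_deriv_def dp_deriv_sum dp_deriv_mult sum.distrib algebra_simps)
qed

interpretation dp: vector_space "dp_scale :: 'k::field \<Rightarrow> ('i, 'k) dpoly \<Rightarrow> _"
  by unfold_locales (simp_all add: dp_scale_def dp_const_add dp_const_mult algebra_simps)

text \<open>Independence of eigenspaces for distinct eigenvalues, in a form that allows summands to
  be zero.\<close>

lemma (in vector_space) eigenvectors_sum_eq_0:
  assumes add: "\<And>v w. E (v + w) = E v + E w" and sc: "\<And>c v. E (scale c v) = scale c (E v)"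
    and inj: "inj c" and eig: "\<And>d. d \<le> n \<Longrightarrow> E (v d) = scale (c d) (v d)"
    and zero: "(\<Sum>d\<le>n. v d) = 0" and "d \<le> (n::nat)"
  shows "v d = 0"
  using eig zero \<open>d \<le> n\<close>
proof (induction n arbitrary: v d)
  case (Suc n)
  have E0: "E 0 = 0" using sc[of 0 0] by simp
  have Esum: "E (\<Sum>d\<in>A. v d) = (\<Sum>d\<in>A. E (v d))" for A
    by (induction A rule: infinite_finite_induct) (simp_all add: add E0)
  \<comment> \<open>Applying E - c(n+1) kills the last summand and multiplies the others by scalars
    that are nonzero because \<open>c\<close> is injective.\<close>
  define w where "w d = scale (c d - c (Suc n)) (v d)" for d
  have "(\<Sum>d\<le>Suc n. w d) = E (\<Sum>d\<le>Suc n. v d) - scale (c (Suc n)) (\<Sum>d\<le>Suc n. v d)"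
    unfolding Esum scale_sum_right sum_subtractf[symmetric] w_def
    by (intro sum.cong refl) (use Suc.prems(1) in \<open>simp add: scale_left_diff_distrib\<close>)
  also have "\<dots> = 0" using Suc.prems(2) E0 by simp
  finally have w0: "(\<Sum>d\<le>n. w d) = 0" by (simp add: w_def)
  have "w d = 0" if "d \<le> n" for d
    by (rule Suc.IH[OF _ w0 that]) (use Suc.prems(1) in \<open>simp add: w_def sc mult.commute\<close>)
  then have v0: "v d = 0" if "d \<le> n" for d
    using that inj_eq[OF inj, of d "Suc n"] by (auto simp: w_def)
  then have "v (Suc n) = 0" using Suc.prems(2) by simp
  with v0 show ?case using Suc.prems(3) le_Suc_eq by auto
qed simp

lemma map_poly_add:
  assumes "h 0 = 0" "\<And>p q. h (p + q) = h p + h q"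
  shows "map_poly h (P + Q) = map_poly h P + map_poly h Q"
  by (rule poly_eqI) (simp add: coeff_map_poly assms)

lemma map_poly_smult_hom:
  assumes "h 0 = 0" "\<And>p q. h (p * q) = h p * h q"
  shows "map_poly h (smult p P) = smult (h p) (map_poly h P)"
  by (rule poly_eqI) (simp add: coeff_map_poly assms)

lemma sum_pCons_0: "(\<Sum>i\<in>A. [:g i:]) = [:\<Sum>i\<in>A. g i:]"
  by (induction A rule: infinite_finite_induct) simp_all

lemma lookup_const_mult: "Poly_Mapping.lookup (dp_const c * p) m = c * Poly_Mapping.lookup p m"
  by (simp add: dp_const_def mult_map_scale_conv_mult[symmetric] map.rep_eq when_def)

section \<open>The graded Lie algebra\<close>

locale short_W_algebra = lie_algebra scale lie
  for scale :: "'k::field_char_0 \<Rightarrow> 'g::ab_group_add \<Rightarrow> 'g" and lie :: "'g \<Rightarrow> 'g \<Rightarrow> 'g" +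
  fixes form :: "'g \<Rightarrow> 'g \<Rightarrow> 'k"
    and bas :: "'i::finite \<Rightarrow> 'g"
    and e x f s :: 'g
    and z :: 'k
    and br :: "('i, 'k) dpoly \<Rightarrow> ('i, 'k) dpoly \<Rightarrow> ('i, 'k) dpoly poly"
    and J0 :: "'a set" and a :: "'a \<Rightarrow> 'g"
    and J1 :: "'b set" and u u' :: "'b \<Rightarrow> 'g"
  assumes bas: "basis_family scale UNIV bas UNIV"
    and form: "nondeg_invariant_form scale lie form"
    and sl2: "sl2_triple scale lie f x e"
    and short: "short_grading scale lie x"
    and s_grade: "s \<in> grade scale lie x 1"
    and br: "affine_lambda_bracket scale lie form bas s z br"
    and a_basis: "basis_family scale J0 a (centralizer0 scale lie x f)"
    and u_basis: "basis_family scale J1 u (grade scale lie x (-1))"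
    and u'_basis: "basis_family scale J1 u' (grade scale lie x 1)"
    and dual: "\<forall>j\<in>J1. \<forall>k\<in>J1. form (u j) (u' k) = (if j = k then 1 else 0)"
begin

abbreviation G :: "int \<Rightarrow> 'g set" where "G \<equiv> grade scale lie x"
abbreviation "Gf \<equiv> centralizer0 scale lie x f"
abbreviation em :: "'g \<Rightarrow> ('i, 'k) dpoly" where "em \<equiv> emb scale bas"

lemma lie_0_left [simp]: "lie 0 b = 0" and lie_0_right [simp]: "lie b 0 = 0"
  using lie_scale_left[of 0 0 b] lie_scale_right[of b 0 0] by simp_all

lemma lie_minus_left: "lie (- b) c = - lie b c" and lie_minus_right: "lie b (- c) = - lie b c"
  using lie_add_left[of "- b" b c] lie_add_right[of b "- c" c] by (simp_all add: eq_neg_iff_add_eq_0)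

lemma lie_diff_right: "lie b (c - c') = lie b c - lie b c'"
  using lie_add_right[of b c "- c'"] by (simp add: lie_minus_right)

lemma lie_sum_right: "lie b (sum g A) = (\<Sum>i\<in>A. lie b (g i))"
  by (induction A rule: infinite_finite_induct) (simp_all add: lie_add_right)

lemma lie_antisym: "lie b c = - lie c b"
  using lie_self[of "b + c"] unfolding lie_add_left lie_add_right
  by (simp add: lie_self eq_neg_iff_add_eq_0 add.commute)

lemma lie_derivation: "lie b (lie c d) = lie (lie b c) d + lie c (lie b d)"
  using jacobi[of b c d] lie_antisym[of d "lie b c"] lie_antisym[of d b]
  by (simp add: lie_minus_right algebra_simps)

lemma form_add_left: "form (b + c) d = form b d + form c d"
  and form_scale_left: "form (scale r b) d = r * form b d"
  and form_sym: "form b c = form c b"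
  and form_inv: "form (lie b c) d = form b (lie c d)"
  using form by (auto simp: nondeg_invariant_form_def)

lemma form_add_right: "form d (b + c) = form d b + form d c"
  and form_scale_right: "form d (scale r b) = r * form d b"
  by (simp_all add: form_sym[of d] form_add_left form_scale_left)

lemma form_0_left [simp]: "form 0 b = 0" and form_0_right [simp]: "form b 0 = 0"
  using form_scale_left[of 0 0 b] form_scale_right[of b 0 0] by simp_all

lemma form_minus_right: "form b (- c) = - form b c"
  using form_add_right[of b c "- c"] by (simp add: eq_neg_iff_add_eq_0 add.commute)

lemma form_minus_left: "form (- b) c = - form b c"
  by (simp add: form_sym[of _ c] form_minus_right)

lemma form_sum_right: "form d (sum g A) = (\<Sum>i\<in>A. form d (g i))"
  by (induction A rule: infinite_finite_induct) (simp_all add: form_add_right)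

lemma form_lie_swap: "form (lie b c) d = - form c (lie b d)"
  by (simp add: lie_antisym[of b c] form_minus_left form_inv)

section \<open>Eigenspaces of ad x\<close>

lemma mem_G: "b \<in> G i \<longleftrightarrow> lie x b = scale (of_int i) b"
  by (simp add: grade_def)

lemma subspace_G: "subspace (G i)"
  by (rule subspaceI) (simp_all add: mem_G lie_add_right lie_scale_right scale_right_distrib mult.commute)

lemma G_lie: "b \<in> G i \<Longrightarrow> c \<in> G j \<Longrightarrow> lie b c \<in> G (i + j)"
  unfolding mem_G by (subst lie_derivation) (simp add: lie_scale_left lie_scale_right scale_left_distrib)

text \<open>The eigenvalues -1, 0, 1 are the roots of t^3 - t. This identity often replaces the
  decomposition of an element into its components.\<close>

lemma ad_x_cubed: "lie x (lie x (lie x b)) = lie x b"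
proof -
  obtain b1 b2 b3 where "b1 \<in> G (-1)" "b2 \<in> G 0" "b3 \<in> G 1" "b = b1 + b2 + b3"
    using short unfolding short_grading_def by metis
  then show ?thesis by (simp add: mem_G lie_add_right lie_diff_right lie_minus_right)
qed

text \<open>A nonzero eigenvector forces i^3 = i, which in characteristic 0 leaves only -1, 0 and
  1.\<close>

lemma G_eq_0:
  assumes "b \<in> G i" "i \<notin> {-1, 0, 1}"
  shows "b = 0"
proof -
  have "lie x (lie x (lie x b)) = lie x b" by (rule ad_x_cubed)
  then have "scale (of_int (i * i * i - i)) b = 0"
    using assms(1) by (simp add: mem_G lie_scale_right scale_left_diff_distrib mult.assoc)
  moreover have "i * i * i - i = i * (i - 1) * (i + 1)" by (simp add: algebra_simps)
  then have "i * i * i - i \<noteq> 0" using assms(2) by auto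
  then have "(of_int (i * i * i - i) :: 'k) \<noteq> 0" by (simp only: of_int_eq_0_iff) simp
  ultimately show ?thesis using scale_eq_0_iff by blast
qed

text \<open>By invariance ad x is skew for the form, hence (i + j)(b|c) = 0.\<close>

lemma form_G_eq_0:
  assumes "b \<in> G i" "c \<in> G j" "i + j \<noteq> 0"
  shows "form b c = 0"
proof -
  have "form (lie x b) c = - form b (lie x c)" by (rule form_lie_swap)
  then have "of_int (i + j) * form b c = 0"
    using assms by (simp add: mem_G form_scale_left form_scale_right distrib_right eq_neg_iff_add_eq_0)
  then show ?thesis using assms(3) by (simp del: of_int_add)
qed

lemma lie_e_f: "lie e f = scale 2 x" and e_G: "e \<in> G 1" and f_G: "f \<in> G (-1)"
  using sl2 by (simp_all add: sl2_triple_def mem_G)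

lemma lie_f_G_m1: "v \<in> G (-1) \<Longrightarrow> lie f v = 0"
  using G_lie[OF f_G, of v "-1"] G_eq_0[of "lie f v" "-2"] by simp

lemma lie_e_G_1: "v \<in> G 1 \<Longrightarrow> lie e v = 0"
  using G_lie[OF e_G, of v 1] G_eq_0[of "lie e v" "2"] by simp

lemma lie_G_m1: "v \<in> G (-1) \<Longrightarrow> w \<in> G (-1) \<Longrightarrow> lie v w = 0"
  using G_lie[of v "-1" w "-1"] G_eq_0[of "lie v w" "-2"] by simp

text \<open>Since [f, v] = 0, only [[f, e], v] = -2 [x, v] survives. So ad e is injective on g_{-1},
  and half of ad f inverts it on its image.\<close>

lemma lie_f_e: "v \<in> G (-1) \<Longrightarrow> lie f (lie e v) = scale 2 v"
  by (subst lie_derivation)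
    (simp add: lie_f_G_m1 lie_antisym[of f e] lie_e_f lie_minus_left lie_scale_left mem_G)

lemma lie_e_f_G_1: "v \<in> G 1 \<Longrightarrow> lie e (lie f v) = scale 2 v"
  by (subst lie_derivation) (simp add: lie_e_G_1 lie_e_f lie_scale_left mem_G)

section \<open>Bases and dual bases\<close>

lemma independent_bas: "independent (range bas)" and span_bas: "span (range bas) = UNIV"
  and inj_bas: "inj bas"
  using bas by (simp_all add: basis_family_def)

text \<open>The finite index type of \<open>bas\<close> bounds every independent set, which is why
  \<open>J0\<close> and \<open>J1\<close> are finite.\<close>

lemma finite_independent: "independent A \<Longrightarrow> finite A"
  using independent_span_bound[of "range bas" A] span_bas by simp

lemma finite_J0: "finite J0" and finite_J1: "finite J1"
  using finite_independent a_basis u_basis finite_imageD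
  unfolding basis_family_def by blast+

lemma span_image_sum:
  assumes "basis_family scale J v S" "finite J" "b \<in> S"
  obtains c where "b = (\<Sum>k\<in>J. scale (c k) (v k))"
proof -
  have "b \<in> span (v ` J)" using assms by (simp add: basis_family_def)
  then obtain c where "b = (\<Sum>w\<in>v ` J. scale (c w) w)"
    using assms(2) by (auto simp: span_finite)
  then have "b = (\<Sum>k\<in>J. scale (c (v k)) (v k))"
    using assms(1) by (simp add: basis_family_def sum.reindex)
  then show ?thesis by (rule that)
qed

lemma u_G: "k \<in> J1 \<Longrightarrow> u k \<in> G (-1)" and u'_G: "k \<in> J1 \<Longrightarrow> u' k \<in> G 1"
  and a_Gf: "j \<in> J0 \<Longrightarrow> a j \<in> Gf"
  using u_basis u'_basis a_basis span_superset unfolding basis_family_def by blast+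

lemma expand_u:
  assumes "v \<in> G (-1)"
  shows "(\<Sum>k\<in>J1. scale (form v (u' k)) (u k)) = v"
proof -
  obtain c where v: "v = (\<Sum>k\<in>J1. scale (c k) (u k))"
    by (rule span_image_sum[OF u_basis finite_J1 assms])
  have "form v (u' j) = c j" if "j \<in> J1" for j
  proof -
    have "form v (u' j) = (\<Sum>k\<in>J1. c k * form (u' j) (u k))"
      unfolding form_sym[of v] by (simp add: v form_sum_right form_scale_right)
    also have "\<dots> = (\<Sum>k\<in>J1. if k = j then c k else 0)"
      by (intro sum.cong refl) (use dual that in \<open>simp add: form_sym[of "u' j"]\<close>)
    finally show ?thesis using that finite_J1 by simp
  qed
  then show ?thesis by (simp add: v)
qed

lemma expand_u':
  assumes "v \<in> G 1"
  shows "(\<Sum>k\<in>J1. scale (form v (u k)) (u' k)) = v"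
proof -
  obtain c where v: "v = (\<Sum>k\<in>J1. scale (c k) (u' k))"
    by (rule span_image_sum[OF u'_basis finite_J1 assms])
  have "form v (u j) = c j" if "j \<in> J1" for j
  proof -
    have "form v (u j) = (\<Sum>k\<in>J1. c k * form (u j) (u' k))"
      unfolding form_sym[of v] by (simp add: v form_sum_right form_scale_right)
    also have "\<dots> = (\<Sum>k\<in>J1. if j = k then c k else 0)"
      by (intro sum.cong refl) (use dual that in simp)
    finally show ?thesis using that finite_J1 by simp
  qed
  then show ?thesis by (simp add: v)
qed

lemma emb_add: "em (b + c) = em b + em c"
  and emb_scale: "em (scale r b) = dp_const r * em b"
  by (simp_all add: emb_def dp_scale_def representation_add representation_scale independent_bas
      span_bas dp_const_add dp_const_mult distrib_right sum.distrib sum_distrib_left mult.assoc)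

lemma emb_0 [simp]: "em 0 = 0"
  using emb_scale[of 0 0] by simp

lemma emb_minus: "em (- b) = - em b"
  using emb_add[of b "- b"] by (simp add: eq_neg_iff_add_eq_0 add.commute)

lemma emb_diff: "em (b - c) = em b - em c"
  using emb_add[of b "- c"] by (simp add: emb_minus)

lemma emb_sum: "em (sum g A) = (\<Sum>i\<in>A. em (g i))"
  by (induction A rule: infinite_finite_induct) (simp_all add: emb_add)

lemma representation_sum_bas: "(\<Sum>i\<in>UNIV. scale (representation (range bas) b (bas i)) (bas i)) = b"
  using sum_representation_eq[OF independent_bas, of b "range bas"] span_bas
  by (simp add: sum.reindex[OF inj_bas])

section \<open>The derivations defining \<open>W\<close>\<close>

text \<open>A linear map on g extends to a differential algebra homomorphism that agrees with
  \<open>L\<close> on all of g, not only on \<open>bas\<close>. This serves both for \<rho> and for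
  the left inverse built later from \<open>theta\<close>.\<close>

lemma dp_eval_emb:
  assumes add: "\<And>b c. L (b + c) = L b + L c" and scale: "\<And>r b. L (scale r b) = dp_const r * L b"
  shows "dp_eval (\<lambda>i. L (bas i)) (em b) = L b"
proof -
  have L0: "L 0 = 0" using scale[of 0 0] by simp
  have Lsum: "L (sum g A) = (\<Sum>i\<in>A. L (g i))" for g and A :: "'i set"
    by (induction A rule: infinite_finite_induct) (simp_all add: add L0)
  have "dp_eval (\<lambda>i. L (bas i)) (em b) = L (\<Sum>i\<in>UNIV. scale (representation (range bas) b (bas i)) (bas i))"
    by (simp add: Lsum scale emb_def dp_eval_sum dp_scale_def dp_eval_mult dp_eval_var)
  then show ?thesis by (simp only: representation_sum_bas)
qed

text \<open>The polynomial (t^2 + t)/2 takes the values 0, 0, 1 at -1, 0, 1, so evaluated at ad x it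
  is the projection to g_1.\<close>

lemma projection_formula:
  assumes "b \<in> G (-1)" "c \<in> G 0" "d \<in> G 1" "y = b + c + d"
  shows "y - scale (1/2) (lie x (lie x y) + lie x y) = b + c"
proof -
  have "lie x (lie x y) + lie x y = scale 2 d"
    using assms by (simp add: mem_G lie_add_right lie_diff_right lie_minus_right
        scale_left_distrib[of 1 1, simplified])
  then show ?thesis using assms(4) by simp
qed

lemma proj_le0_eq: "proj_le0 scale lie x y = y - scale (1/2) (lie x (lie x y) + lie x y)"
  unfolding proj_le0_def
proof (rule the_equality)
  obtain b c d where y: "b \<in> G (-1)" "c \<in> G 0" "d \<in> G 1" "y = b + c + d"
    using short unfolding short_grading_def by metis
  then show "y - scale (1/2) (lie x (lie x y) + lie x y) \<in> grade_le0 scale lie x \<and>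
      y - (y - scale (1/2) (lie x (lie x y) + lie x y)) \<in> G 1"
    unfolding projection_formula[OF y] by (auto simp: grade_le0_def)
next
  fix w assume w: "w \<in> grade_le0 scale lie x \<and> y - w \<in> G 1"
  then obtain b c where bc: "b \<in> G (-1)" "c \<in> G 0" "w = b + c" by (auto simp: grade_le0_def)
  then show "w = y - scale (1/2) (lie x (lie x y) + lie x y)"
    using projection_formula[OF bc(1,2), of "y - w" y] w by simp
qed

abbreviation \<rho> where "\<rho> \<equiv> rho scale lie form bas x f"

lemma proj_le0_add: "proj_le0 scale lie x (b + c) = proj_le0 scale lie x b + proj_le0 scale lie x c"
  and proj_le0_scale: "proj_le0 scale lie x (scale r b) = scale r (proj_le0 scale lie x b)"
  by (simp_all add: proj_le0_eq lie_add_right lie_scale_right scale_right_distrib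
      scale_right_diff_distrib mult.commute)

lemma rho_emb: "\<rho> (em b) = em (proj_le0 scale lie x b) + dp_const (form f b)"
  unfolding rho_def
  by (rule dp_eval_emb)
    (simp_all add: proj_le0_add proj_le0_scale form_add_right form_scale_right dp_const_add
      dp_const_mult emb_add emb_scale algebra_simps)

lemma rho_0 [simp]: "\<rho> 0 = 0" and rho_add: "\<rho> (p + q) = \<rho> p + \<rho> q"
  and rho_mult: "\<rho> (p * q) = \<rho> p * \<rho> q" and rho_const [simp]: "\<rho> (dp_const c) = dp_const c"
  and rho_deriv: "\<rho> (dp_deriv p) = dp_deriv (\<rho> p)"
  by (simp_all add: rho_def dp_eval_add dp_eval_mult dp_eval_deriv)

lemma form_f_eq_0: "b \<in> G (-1) \<or> b \<in> G 0 \<Longrightarrow> form f b = 0"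
  using form_G_eq_0[OF f_G, of b "-1"] form_G_eq_0[OF f_G, of b 0] by auto

text \<open>As f has degree -1, it pairs nontrivially only with g_1.\<close>

lemma rho_emb_m1: "b \<in> G (-1) \<Longrightarrow> \<rho> (em b) = em b"
  and rho_emb_0: "b \<in> G 0 \<Longrightarrow> \<rho> (em b) = em b"
  and rho_emb_1: "b \<in> G 1 \<Longrightarrow> \<rho> (em b) = dp_const (form f b)"
  using form_f_eq_0[of b]
  by (simp_all add: rho_emb proj_le0_eq mem_G lie_minus_right
      scale_left_distrib[of 1 1, simplified, symmetric])

section \<open>The differential algebra over g_{-1} + g_0\<close>

abbreviation "V0 \<equiv> V_le0 scale lie bas x"

lemma V0_add: "p \<in> V0 \<Longrightarrow> q \<in> V0 \<Longrightarrow> p + q \<in> V0"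
  and V0_mult: "p \<in> V0 \<Longrightarrow> q \<in> V0 \<Longrightarrow> p * q \<in> V0"
  and V0_deriv: "p \<in> V0 \<Longrightarrow> dp_deriv p \<in> V0"
  and V0_const: "dp_const c \<in> V0"
  unfolding V_le0_def by (auto intro: diff_subalgebra.intros)

lemma grade_le0I: "b \<in> G (-1) \<or> b \<in> G 0 \<Longrightarrow> b \<in> grade_le0 scale lie x"
  using subspace_0[OF subspace_G] unfolding grade_le0_def by force

lemma V0_emb: "b \<in> G (-1) \<or> b \<in> G 0 \<Longrightarrow> em b \<in> V0"
  unfolding V_le0_def by (intro diff_subalgebra.gen imageI grade_le0I)

lemma V0_sum: "(\<And>i. i \<in> A \<Longrightarrow> g i \<in> V0) \<Longrightarrow> sum g A \<in> V0"
  using V0_const[of 0] by (induction A rule: infinite_finite_induct) (auto intro: V0_add)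

lemma V0_diff: "p \<in> V0 \<Longrightarrow> q \<in> V0 \<Longrightarrow> p - q \<in> V0"
  using V0_add[OF _ V0_mult[OF V0_const[of "-1"]], of p q] by (simp add: dp_const_uminus)

text \<open>A homomorphism of differential algebras that fixes the generators g_{-1} and g_0 fixes
  everything they generate.\<close>

lemma rho_V0: "p \<in> V0 \<Longrightarrow> \<rho> p = p"
  unfolding V_le0_def
proof (induction rule: diff_subalgebra.induct)
  case (gen p)
  then show ?case by (auto simp: grade_le0_def emb_add rho_add rho_emb_m1 rho_emb_0)
qed (simp_all add: rho_add rho_mult rho_deriv)

section \<open>The bracket with g_1, followed by \<rho>\<close>

definition Dr :: "'g \<Rightarrow> ('i, 'k) dpoly \<Rightarrow> ('i, 'k) dpoly poly" where
  "Dr c g = map_poly \<rho> (br (em c) g)"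

lemmas br_conditions = br[unfolded affine_lambda_bracket_def dp_scale_def]
lemmas br_add_right = br_conditions[THEN conjunct2, THEN conjunct1, rule_format]
lemmas br_const_mult_right = br_conditions[THEN conjunct2, THEN conjunct2, THEN conjunct2, THEN conjunct1, rule_format]
lemmas br_deriv_right = br_conditions[THEN conjunct2, THEN conjunct2, THEN conjunct2, THEN conjunct2, THEN conjunct2,
    THEN conjunct1, rule_format]
lemmas br_mult_right = br_conditions[THEN conjunct2, THEN conjunct2, THEN conjunct2, THEN conjunct2, THEN conjunct2,
    THEN conjunct2, THEN conjunct1, rule_format]
lemmas br_emb = br_conditions[THEN conjunct2, THEN conjunct2, THEN conjunct2, THEN conjunct2, THEN conjunct2,
    THEN conjunct2, THEN conjunct2, THEN conjunct2, rule_format]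

text \<open>In the Leibniz rule \<rho> is also applied to the cofactors; it fixes them if they lie
  in \<open>V0\<close>, hence the restriction in \<open>Dr_mult\<close>.\<close>

lemma Dr_add: "Dr c (g + h) = Dr c g + Dr c h"
  and Dr_deriv: "Dr c (dp_deriv g) = lam_deriv (Dr c g)"
  and Dr_mult: "g \<in> V0 \<Longrightarrow> h \<in> V0 \<Longrightarrow> Dr c (g * h) = smult h (Dr c g) + smult g (Dr c h)"
  unfolding Dr_def br_add_right br_deriv_right br_mult_right
  by (simp_all add: map_poly_add map_poly_smult_hom rho_add rho_mult map_poly_lam_deriv rho_deriv rho_V0)

lemma Dr_const_mult: "Dr c (dp_const r * g) = smult (dp_const r) (Dr c g)"
  unfolding Dr_def br_const_mult_right by (simp add: map_poly_smult_hom rho_mult)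

lemma Dr_0 [simp]: "Dr c 0 = 0"
  using Dr_const_mult[of c 0 0] by simp

lemma Dr_const [simp]: "Dr c (dp_const r) = 0"
proof -
  have "Dr c (1 * 1) = Dr c 1 + Dr c 1" using Dr_mult[of 1 1 c] V0_const[of 1] by simp
  then show ?thesis using Dr_const_mult[of c r 1] by simp
qed

lemma Dr_uminus: "Dr c (- g) = - Dr c g"
  using Dr_add[of c g "- g"] by (simp add: eq_neg_iff_add_eq_0 add.commute)

lemma Dr_diff: "Dr c (g - h) = Dr c g - Dr c h"
  using Dr_add[of c g "- h"] by (simp add: Dr_uminus)

lemma Dr_sum: "Dr c (sum g A) = (\<Sum>i\<in>A. Dr c (g i))"
  by (induction A rule: infinite_finite_induct) (simp_all add: Dr_add)

text \<open>[c, b] lies in g_1, where \<rho> takes the constant value (f | [c, b]); the terms with s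
  and with \<lambda> vanish by degree.\<close>

lemma Dr_emb_0:
  assumes c: "c \<in> G 1" and b: "b \<in> G 0"
  shows "Dr c (em b) = [: dp_const (form c (lie b f)) :]"
proof -
  have l: "lie c b \<in> G 1" using G_lie[OF c b] by simp
  have "form s (lie c b) = 0" "form c b = 0" using form_G_eq_0 s_grade l c b by fastforce+
  moreover have "form f (lie c b) = form c (lie b f)" by (simp add: form_sym[of f] form_inv)
  ultimately show ?thesis by (simp add: Dr_def br_emb map_poly_pCons rho_emb_1[OF l])
qed

text \<open>Here [c, b] lies in g_0, which \<rho> fixes. The term with s still vanishes by degree,
  but the pairing of g_1 with g_{-1} leaves a \<lambda>-term.\<close>

lemma Dr_emb_m1:
  assumes c: "c \<in> G 1" and b: "b \<in> G (-1)"
  shows "Dr c (em b) = [: em (lie c b), dp_const (form c b) :]"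
proof -
  have l: "lie c b \<in> G 0" using G_lie[OF c b] by simp
  have "form s (lie c b) = 0" using form_G_eq_0 s_grade l by fastforce
  then show ?thesis by (simp add: Dr_def br_emb map_poly_pCons rho_emb_0[OF l])
qed

lemma Dr_emb_emb_0:
  assumes "c \<in> G 1" "b \<in> G 0" "b' \<in> G 0"
  shows "Dr c (em b * em b') = [: em (scale (form c (lie b f)) b' + scale (form c (lie b' f)) b) :]"
  using assms by (simp add: Dr_mult V0_emb Dr_emb_0 emb_add emb_scale mult.commute)

section \<open>Annihilation of \<psi>(v) by the derivations\<close>

abbreviation "\<psi> \<equiv> psi scale lie bas e f J1 u u'"

lemma G0_lie_m1_1: "b \<in> G (-1) \<Longrightarrow> c \<in> G 1 \<Longrightarrow> lie b c \<in> G 0"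
  and G0_lie_1_m1: "b \<in> G (-1) \<Longrightarrow> c \<in> G 1 \<Longrightarrow> lie c b \<in> G 0"
  using G_lie[of b "-1" c 1] G_lie[of c 1 b "-1"] by simp_all

lemma Gm1_lie: "b \<in> G 0 \<Longrightarrow> c \<in> G (-1) \<Longrightarrow> lie b c \<in> G (-1)"
  and Gm1_lie': "b \<in> G 0 \<Longrightarrow> c \<in> G (-1) \<Longrightarrow> lie c b \<in> G (-1)"
  using G_lie[of b 0 c "-1"] G_lie[of c "-1" b 0] by simp_all

lemma circ_G: "v \<in> G (-1) \<Longrightarrow> w \<in> G (-1) \<Longrightarrow> circ lie e v w \<in> G (-1)"
  unfolding circ_def by (intro Gm1_lie G0_lie_1_m1 e_G)

lemma psi_factors_G0:
  assumes "v \<in> G (-1)" "k \<in> J1"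
  shows "lie v (u' k) \<in> G 0" "lie e (u k) \<in> G 0" "lie f (u' k) \<in> G 0"
    "lie e (circ lie e v (u k)) \<in> G 0"
  using assms by (auto intro: G0_lie_m1_1 G0_lie_1_m1 circ_G u_G u'_G e_G f_G)

lemma form_lie_f: "form c (lie b f) = form (lie f c) b"
proof -
  have "form (lie f c) b = - form c (lie f b)" by (rule form_lie_swap)
  then show ?thesis by (simp add: lie_antisym[of b f] form_minus_right)
qed

lemma form_lie_e_f: "v \<in> G (-1) \<Longrightarrow> form c (lie (lie e v) f) = - 2 * form c v"
  by (simp add: lie_antisym[of _ f] lie_f_e form_minus_right form_scale_right)

text \<open>g_{-1} is abelian, so applying the derivation ad e to [v, w] = 0 gives [[e, v], w] + [v,
  [e, w]] = 0.\<close>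

lemma circ_commute:
  assumes "v \<in> G (-1)" "w \<in> G (-1)"
  shows "circ lie e v w = circ lie e w v"
  using lie_derivation[of e v w] lie_G_m1[OF assms] by (simp add: circ_def lie_antisym[of v "lie e w"])

text \<open>By invariance the first coefficients are ([[f, c], v] | \<open>u' k\<close>) and the
  second ones are -2 (c | \<open>u k\<close>); the expansions of [[f, c], v] and of c in the dual
  bases then collapse the sums.\<close>

lemma psi_bracket_sum1:
  assumes c: "c \<in> G 1" and v: "v \<in> G (-1)"
  shows "(\<Sum>k\<in>J1. scale (form c (lie (lie v (u' k)) f)) (lie e (u k))
      + scale (form c (lie (lie e (u k)) f)) (lie v (u' k)))
    = lie e (lie (lie f c) v) - scale 2 (lie v c)"
proof -
  have y: "lie (lie f c) v \<in> G (-1)" by (intro Gm1_lie G0_lie_m1_1 f_G c v)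
  have "(\<Sum>k\<in>J1. scale (form c (lie (lie v (u' k)) f)) (lie e (u k)))
      = lie e (\<Sum>k\<in>J1. scale (form (lie (lie f c) v) (u' k)) (u k))"
    by (simp add: lie_sum_right lie_scale_right form_lie_f form_inv)
  moreover have "(\<Sum>k\<in>J1. scale (form c (lie (lie e (u k)) f)) (lie v (u' k)))
      = - scale 2 (lie v (\<Sum>k\<in>J1. scale (form c (u k)) (u' k)))"
    by (simp add: lie_sum_right lie_scale_right form_lie_e_f u_G scale_sum_right sum_negf)
  ultimately show ?thesis by (simp add: sum.distrib expand_u[OF y] expand_u'[OF c])
qed

text \<open>The same collapse, now with the expansions of y = [[f, c], f] and z = [c, [e, v]]; each
  half contributes -2 [e, [[f, c], v]].\<close>

lemma psi_bracket_sum2: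
  assumes c: "c \<in> G 1" and v: "v \<in> G (-1)"
  shows "(\<Sum>k\<in>J1. scale (form c (lie (lie f (u' k)) f)) (lie e (circ lie e v (u k)))
      + scale (form c (lie (lie e (circ lie e v (u k))) f)) (lie f (u' k)))
    = - scale 4 (lie e (lie (lie f c) v))"
proof -
  have fc: "lie f c \<in> G 0" by (intro G0_lie_m1_1 f_G c)
  let ?y = "lie (lie f c) f" and ?z = "lie c (lie e v)"
  have y: "?y \<in> G (-1)" by (intro Gm1_lie fc f_G)
  have z: "?z \<in> G 1" using G_lie[OF c G0_lie_1_m1[OF v e_G]] by simp
  have "lie e (lie f (lie f c)) = scale 2 (lie f c)"
  proof -
    have "lie x (lie f c) = 0" using fc by (simp add: mem_G)
    then show ?thesis
      by (subst lie_derivation) (simp add: lie_e_f lie_e_f_G_1[OF c] lie_scale_left lie_scale_right)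
  qed
  then have ey: "lie e ?y = - scale 2 (lie f c)"
    by (simp add: lie_antisym[of _ f] lie_minus_right)
  \<comment> \<open>Commutativity of the product brings \<open>?y\<close> under ad e, where [e, y] =
    -2 [f, c].\<close>
  have cy: "circ lie e v ?y = - scale 2 (lie (lie f c) v)"
    by (simp add: circ_commute[OF v y]) (simp add: circ_def ey lie_minus_left lie_scale_left)
  \<comment> \<open>Both sides equal [[f, c], [e, v]] + 2 [c, v].\<close>
  have fz: "lie f ?z = lie e (lie (lie f c) v)"
  proof -
    have "lie f ?z = lie (lie f c) (lie e v) + scale 2 (lie c v)"
      by (subst lie_derivation) (simp add: lie_f_e[OF v] lie_scale_right)
    moreover have "lie e (lie (lie f c) v) = scale 2 (lie c v) + lie (lie f c) (lie e v)"
      by (subst lie_derivation) (simp add: lie_e_f_G_1[OF c] lie_scale_left)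
    ultimately show ?thesis by simp
  qed
  have "(\<Sum>k\<in>J1. scale (form c (lie (lie f (u' k)) f)) (lie e (circ lie e v (u k))))
      = lie e (circ lie e v (\<Sum>k\<in>J1. scale (form ?y (u' k)) (u k)))"
    by (simp add: circ_def lie_sum_right lie_scale_right form_lie_f form_inv)
  also have "\<dots> = - scale 2 (lie e (lie (lie f c) v))"
    by (simp add: expand_u[OF y] cy lie_minus_right lie_scale_right)
  finally have s1: "(\<Sum>k\<in>J1. scale (form c (lie (lie f (u' k)) f)) (lie e (circ lie e v (u k))))
      = - scale 2 (lie e (lie (lie f c) v))" .
  have "form c (lie (lie e (circ lie e v (u k))) f) = - 2 * form ?z (u k)" if "k \<in> J1" for k
    by (simp add: form_lie_e_f circ_G v u_G that) (simp add: circ_def form_inv)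
  then have "(\<Sum>k\<in>J1. scale (form c (lie (lie e (circ lie e v (u k))) f)) (lie f (u' k)))
      = - scale 2 (lie f (\<Sum>k\<in>J1. scale (form ?z (u k)) (u' k)))"
    by (simp add: lie_sum_right lie_scale_right scale_sum_right sum_negf)
  also have "\<dots> = - scale 2 (lie e (lie (lie f c) v))"
    by (simp add: expand_u'[OF z] fz)
  finally show ?thesis
    by (simp add: sum.distrib s1 scale_left_distrib[of 2 2, simplified])
qed

lemma psi_V0:
  assumes v: "v \<in> G (-1)"
  shows "\<psi> v \<in> V0"
  unfolding psi_def dp_scale_def
  by (intro V0_add V0_diff V0_mult V0_const V0_sum V0_deriv V0_emb)
    (use v psi_factors_G0 G0_lie_1_m1 e_G in auto)

text \<open>With Y = [e, [[f, c], v]] the part free of \<lambda> is [c, v] - (Y - 2 [v, c])/2 + 4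
  Y/8 = 0, and the coefficient of \<lambda> is (c | v) - 2 (c | v)/2 = 0. This explains the factors
  1/2, 1/8, 1/2 in \<open>psi\<close>.\<close>

lemma Dr_psi:
  assumes c: "c \<in> G 1" and v: "v \<in> G (-1)"
  shows "Dr c (\<psi> v) = 0"
proof -
  have sum1: "Dr c (\<Sum>k\<in>J1. em (lie v (u' k)) * em (lie e (u k)))
      = [: em (lie e (lie (lie f c) v) - scale 2 (lie v c)) :]"
    unfolding psi_bracket_sum1[OF assms, symmetric]
    by (simp add: Dr_sum sum_pCons_0 emb_sum Dr_emb_emb_0 c v psi_factors_G0[OF v])
  have sum2: "Dr c (\<Sum>k\<in>J1. em (lie f (u' k)) * em (lie e (circ lie e v (u k))))
      = [: em (- scale 4 (lie e (lie (lie f c) v))) :]"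
    unfolding psi_bracket_sum2[OF assms, symmetric]
    by (simp add: Dr_sum sum_pCons_0 emb_sum Dr_emb_emb_0 c v psi_factors_G0[OF v])
  have der: "Dr c (dp_deriv (em (lie e v))) = [: 0, dp_const (- 2 * form c v) :]"
    using v c by (simp add: Dr_deriv Dr_emb_0 G0_lie_1_m1 e_G lam_deriv_constant form_lie_e_f)
  let ?y = "lie e (lie (lie f c) v)"
  have "lie c v - scale (1/2) (?y - scale 2 (lie v c)) - scale (1/8) (- scale 4 ?y) = 0"
    by (simp add: scale_right_diff_distrib scale_right_distrib lie_antisym[of v c])
  then have "em (lie c v - scale (1/2) (?y - scale 2 (lie v c)) - scale (1/8) (- scale 4 ?y)) = 0"
    by simp
  then have em0: "em (lie c v) - dp_const (1/2) * em (?y - scale 2 (lie v c))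
      - dp_const (1/8) * em (- scale 4 ?y) = 0"
    by (simp only: emb_diff[of _ "scale _ _"] emb_scale)
  have const0: "dp_const (form c v) + dp_const (1/2) * dp_const (- 2 * form c v) = 0"
    by (simp flip: dp_const_mult dp_const_add)
  show ?thesis
    unfolding psi_def dp_scale_def Dr_add Dr_diff Dr_const_mult sum1 sum2 der Dr_emb_m1[OF c v]
    using em0 const0 by simp
qed


section \<open>W as the common kernel of the derivations\<close>

abbreviation "W \<equiv> W_alg scale lie form bas x f br"

lemma W_iff: "g \<in> W \<longleftrightarrow> g \<in> V0 \<and> (\<forall>c\<in>G 1. Dr c g = 0)"
  by (simp add: W_alg_def Dr_def)

lemma W_add: "p \<in> W \<Longrightarrow> q \<in> W \<Longrightarrow> p + q \<in> W"
  and W_mult: "p \<in> W \<Longrightarrow> q \<in> W \<Longrightarrow> p * q \<in> W"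
  and W_deriv: "p \<in> W \<Longrightarrow> dp_deriv p \<in> W"
  and W_const: "dp_const r \<in> W"
  by (simp_all add: W_iff V0_add V0_mult V0_deriv V0_const Dr_add Dr_mult Dr_deriv lam_deriv_def)

lemma W_diff: "p \<in> W \<Longrightarrow> q \<in> W \<Longrightarrow> p - q \<in> W"
  by (simp add: W_iff V0_diff Dr_diff)

lemma psi_W: "v \<in> G (-1) \<Longrightarrow> \<psi> v \<in> W"
  by (simp add: W_iff psi_V0 Dr_psi)

lemma Gf_iff: "b \<in> Gf \<longleftrightarrow> b \<in> G 0 \<and> lie f b = 0"
  by (simp add: centralizer0_def)

lemma emb_Gf_W: "b \<in> Gf \<Longrightarrow> em b \<in> W"
  by (simp add: Gf_iff W_iff V0_emb Dr_emb_0 lie_antisym[of b f])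

text \<open>[b, f] lies in g_{-1}, so it is determined by its pairings with the \<open>u' k\<close>.
  This is the converse needed to detect g_0^f inside W.\<close>

lemma Gf_of_form_eq_0:
  assumes b: "b \<in> G 0" and 0: "\<And>c. c \<in> G 1 \<Longrightarrow> form c (lie b f) = 0"
  shows "b \<in> Gf"
proof -
  have "lie b f \<in> G (-1)" by (rule Gm1_lie[OF b f_G])
  then have "lie b f = (\<Sum>k\<in>J1. scale (form (lie b f) (u' k)) (u k))" by (rule expand_u[symmetric])
  also have "\<dots> = 0" by (simp add: form_sym[of "lie b f"] 0 u'_G)
  finally show ?thesis using b by (simp add: Gf_iff lie_antisym[of f b])
qed

lemma psi_add: "\<psi> (v + w) = \<psi> v + \<psi> w"
  by (simp add: psi_def circ_def lie_add_left lie_add_right emb_add dp_deriv_add distrib_left distrib_right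
      sum.distrib dp_scale_def)

lemma psi_scale: "\<psi> (scale r v) = dp_const r * \<psi> v"
  by (simp add: psi_def circ_def lie_scale_left lie_scale_right emb_scale dp_deriv_const_mult dp_scale_def
      algebra_simps sum_distrib_left)

lemma psi_0: "\<psi> 0 = 0"
  using psi_scale[of 0 0] by simp

section \<open>Generators\<close>

abbreviation "JJ \<equiv> J0 <+> J1"
abbreviation "gens \<equiv> case_sum (\<lambda>i. em (a i)) (\<lambda>k. \<psi> (u k))"
text \<open>The differential subalgebra generated by \<open>gens\<close>, written as an image so
  that \<open>C = W\<close> is the surjectivity required by
  \<open>is_diff_poly_algebra_on\<close>.\<close>

abbreviation "C \<equiv> dp_eval gens ` dpolys JJ"

lemma C_add: "p \<in> C \<Longrightarrow> q \<in> C \<Longrightarrow> p + q \<in> C"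
  and C_mult: "p \<in> C \<Longrightarrow> q \<in> C \<Longrightarrow> p * q \<in> C"
  and C_deriv: "p \<in> C \<Longrightarrow> dp_deriv p \<in> C"
  and C_const: "dp_const r \<in> C"
  by (auto simp flip: dp_eval_add dp_eval_mult dp_eval_deriv intro!: imageI dpolys_add dpolys_mult dpolys_deriv)
    (metis dp_eval_const dpolys_const imageI)

lemma C_gens: "j \<in> JJ \<Longrightarrow> gens j \<in> C"
  by (rule image_eqI[of _ _ "dp_var j 0"]) (simp_all add: dp_eval_var dpolys_var)

lemma C_sum: "(\<And>i. i \<in> A \<Longrightarrow> g i \<in> C) \<Longrightarrow> sum g A \<in> C"
  by (induction A rule: infinite_finite_induct) (use C_const[of 0] C_add in auto)

lemma emb_Gf_C:
  assumes "b \<in> Gf"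
  shows "em b \<in> C"
proof -
  obtain c where b: "b = (\<Sum>j\<in>J0. scale (c j) (a j))"
    by (rule span_image_sum[OF a_basis finite_J0 assms])
  have "em (a j) \<in> C" if "j \<in> J0" for j using C_gens[OF InlI, of j] that by simp
  then show ?thesis unfolding b emb_sum emb_scale by (intro C_sum C_mult C_const)
qed

lemma psi_C:
  assumes "v \<in> G (-1)"
  shows "\<psi> v \<in> C"
proof -
  obtain c where v: "v = (\<Sum>j\<in>J1. scale (c j) (u j))"
    by (rule span_image_sum[OF u_basis finite_J1 assms])
  have "\<psi> (\<Sum>j\<in>A. scale (c j) (u j)) = (\<Sum>j\<in>A. dp_const (c j) * \<psi> (u j))" for A
    by (induction A rule: infinite_finite_induct) (simp_all add: psi_0 psi_add psi_scale)
  moreover have "\<psi> (u j) \<in> C" if "j \<in> J1" for j using C_gens[OF InrI, of j] that by simp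
  ultimately show ?thesis unfolding v by (auto intro!: C_sum C_mult C_const)
qed

text \<open>W is a differential subalgebra and contains the generators.\<close>

lemma C_subset_W: "C \<subseteq> W"
proof (rule image_subsetI)
  fix p :: "('a + 'b, 'k) dpoly" assume "p \<in> dpolys JJ"
  then show "dp_eval gens p \<in> W"
  proof (induction rule: dpolys_induct)
    case (var j m)
    then have "gens j \<in> W" by (auto simp: a_Gf emb_Gf_W u_G psi_W)
    then have "(dp_deriv ^^ m) (gens j) \<in> W" by (induction m) (auto intro: W_deriv)
    then show ?case by (simp add: dp_eval_var)
  qed (simp_all add: W_const dp_eval_add W_add dp_eval_mult W_mult)
qed

text \<open>In the coordinates \<open>a\<^sub>i\<close>, \<open>h\<^sub>k = [e, u\<^sub>k]\<close>, \<open>\<psi>(u\<^sub>k)\<close> this is \<open>-2\<close> times the Euler operator of the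
  variables \<open>h\<^sub>k\<^sup>(\<^sup>m\<^sup>)\<close>.\<close>

definition Euler :: "('i, 'k) dpoly \<Rightarrow> ('i, 'k) dpoly" where
  "Euler g = (\<Sum>k\<in>J1. apply_deriv (em (lie e (u k))) (Dr (u' k) g))"

text \<open>\<open>Dr\<close> turns \<partial> into \<partial> + \<lambda>, and substituting
  \<partial> for \<lambda> undoes this shift; the result is an ordinary derivation on
  \<open>V0\<close> that commutes with \<partial>.\<close>

lemma Euler_add: "Euler (g + h) = Euler g + Euler h"
  and Euler_const_mult: "Euler (dp_const r * g) = dp_const r * Euler g"
  and Euler_deriv: "Euler (dp_deriv g) = dp_deriv (Euler g)"
  and Euler_mult: "g \<in> V0 \<Longrightarrow> h \<in> V0 \<Longrightarrow> Euler (g * h) = h * Euler g + g * Euler h"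
  by (simp_all add: Euler_def Dr_add Dr_const_mult Dr_deriv Dr_mult apply_deriv_add apply_deriv_smult
      apply_deriv_lam_deriv sum.distrib sum_distrib_left dp_deriv_sum)

lemma Euler_scale: "Euler (dp_scale r g) = dp_scale r (Euler g)"
  by (simp add: dp_scale_def Euler_const_mult)

lemma Euler_0 [simp]: "Euler 0 = 0"
  using Euler_const_mult[of 0 0] by simp

lemma Euler_sum: "Euler (sum g A) = (\<Sum>i\<in>A. Euler (g i))"
  by (induction A rule: infinite_finite_induct) (simp_all add: Euler_add)

lemma Euler_W: "g \<in> W \<Longrightarrow> Euler g = 0"
  by (simp add: Euler_def W_iff u'_G)

text \<open>The expansion of [b, f] in the basis \<open>u\<close> collapses the sum.\<close>

lemma Euler_emb_0:
  assumes b: "b \<in> G 0"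
  shows "Euler (em b) = em (lie e (lie b f))"
proof -
  have "Euler (em b) = em (lie e (\<Sum>k\<in>J1. scale (form (lie b f) (u' k)) (u k)))"
    by (simp add: Euler_def Dr_emb_0 u'_G b form_sym[of "lie b f"] lie_sum_right lie_scale_right emb_sum emb_scale)
  then show ?thesis by (simp add: expand_u Gm1_lie[OF b f_G])
qed

section \<open>The splitting of g_0 into g_0^f and [e, g_{-1}]\<close>

definition pr_e :: "'g \<Rightarrow> 'g" where "pr_e b = scale (1/2) (lie e (lie f b))"

lemma pr_e_G0: "b \<in> G 0 \<Longrightarrow> pr_e b \<in> G 0"
  unfolding pr_e_def
  by (intro subspace_scale[OF subspace_G] G0_lie_1_m1 e_G Gm1_lie' f_G)

text \<open>From [f, [e, [f, b]]] = 2 [f, b] it follows that b and \<open>pr_e b\<close> have the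
  same bracket with f. Thus \<open>pr_e\<close> is the projection of g_0 to [e, g_{-1}] along
  g_0^f.\<close>

lemma pr_e_compl: "b \<in> G 0 \<Longrightarrow> b - pr_e b \<in> Gf"
  by (simp add: Gf_iff subspace_diff[OF subspace_G] pr_e_G0)
    (simp add: pr_e_def lie_diff_right lie_scale_right lie_f_e Gm1_lie' f_G)

text \<open>\<open>Euler\<close> sends \<open>pr_e b\<close> to -[e, [f, b]], which is -2 times
  \<open>pr_e b\<close>: elements of [e, g_{-1}] have degree 1 in the variables [e, u_k].\<close>

lemma Euler_pr_e:
  assumes b: "b \<in> G 0"
  shows "Euler (em (pr_e b)) = dp_scale (-2) (em (pr_e b))"
proof -
  have "lie f (pr_e b) = lie f b"
    by (simp add: pr_e_def lie_scale_right lie_f_e Gm1_lie'[OF b f_G])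
  then have "lie e (lie (pr_e b) f) = scale (- 2) (pr_e b)"
    by (simp add: lie_antisym[of "pr_e b" f] lie_minus_right) (simp add: pr_e_def)
  then show ?thesis by (simp only: Euler_emb_0[OF pr_e_G0[OF b]] emb_scale dp_scale_def)
qed

text \<open>The elements of degree d in the variables [e, u_k]. In degree 0 membership in
  \<open>C\<close> is built in: it survives sums, products and \<partial>, whereas deducing it from
  \<open>Euler g = 0\<close> is the point to be proved.\<close>

definition eigen :: "nat \<Rightarrow> ('i, 'k) dpoly set" where
  "eigen d = {g \<in> V0. Euler g = dp_scale (-2 * of_nat d) g \<and> (d = 0 \<longrightarrow> g \<in> C)}"

lemma eigen_0: "0 \<in> eigen d"
  using V0_const[of 0] C_const[of 0] by (simp add: eigen_def)

lemma C_eigen: "g \<in> C \<Longrightarrow> g \<in> eigen 0"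
  using C_subset_W Euler_W by (auto simp: eigen_def W_iff)

lemma eigen_add: "g \<in> eigen d \<Longrightarrow> h \<in> eigen d \<Longrightarrow> g + h \<in> eigen d"
  by (simp add: eigen_def V0_add Euler_add C_add dp.scale_right_distrib)

lemma Euler_eigen_mult:
  assumes "g \<in> V0" "h \<in> V0" "Euler g = dp_scale r g" "Euler h = dp_scale r' h"
  shows "Euler (g * h) = dp_scale (r + r') (g * h)"
  using assms by (simp add: Euler_mult dp_scale_def dp_const_add distrib_left mult_ac)

text \<open>If d + d' = 0 then d = d' = 0, so the condition on \<open>C\<close> passes to
  products.\<close>

lemma eigen_mult:
  assumes g: "g \<in> eigen d" and h: "h \<in> eigen d'"
  shows "g * h \<in> eigen (d + d')"
proof -
  have "Euler (g * h) = dp_scale (-2 * of_nat d + -2 * of_nat d') (g * h)"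
    using g h by (intro Euler_eigen_mult) (simp_all add: eigen_def)
  also have "-2 * of_nat d + -2 * of_nat d' = (-2 * of_nat (d + d') :: 'k)"
    by (simp add: algebra_simps)
  finally show ?thesis using g h by (simp add: eigen_def V0_mult C_mult)
qed

lemma eigen_deriv: "g \<in> eigen d \<Longrightarrow> dp_deriv g \<in> eigen d"
  by (auto simp: eigen_def V0_deriv Euler_deriv C_deriv dp_scale_def dp_deriv_const_mult)

text \<open>As 0 lies in every \<open>eigen d\<close>, a summand can be chosen for all d at once,
  and sums of different lengths are padded with zeros.\<close>

definition eigen_sums :: "('i, 'k) dpoly set" where
  "eigen_sums = {g. \<exists>n h. (\<forall>d. h d \<in> eigen d) \<and> g = (\<Sum>d\<le>(n::nat). h d)}"

lemma eigen_eigen_sums: "g \<in> eigen d \<Longrightarrow> g \<in> eigen_sums"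
  unfolding eigen_sums_def
  by (intro CollectI exI[of _ d] exI[of _ "\<lambda>i. if i = d then g else 0"]) (auto simp: eigen_0)

lemma eigen_sums_add:
  assumes "g \<in> eigen_sums" "g' \<in> eigen_sums"
  shows "g + g' \<in> eigen_sums"
proof -
  obtain n h n' h' where h: "\<And>d. h d \<in> eigen d" "\<And>d. h' d \<in> eigen d"
    and g: "g = (\<Sum>d\<le>n. h d)" "g' = (\<Sum>d\<le>n'. h' d)"
    using assms by (auto simp: eigen_sums_def)
  define k where "k d = (if d \<le> n then h d else 0) + (if d \<le> n' then h' d else 0)" for d
  have "k d \<in> eigen d" for d by (auto simp: k_def h eigen_0 eigen_add)
  moreover have "(\<Sum>d\<le>max n n'. if d \<le> n then h d else 0) = g"
    unfolding g by (rule sum.mono_neutral_cong_right) auto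
  moreover have "(\<Sum>d\<le>max n n'. if d \<le> n' then h' d else 0) = g'"
    unfolding g by (rule sum.mono_neutral_cong_right) auto
  ultimately show ?thesis unfolding eigen_sums_def
    by (intro CollectI exI[of _ "max n n'"] exI[of _ k]) (simp add: k_def sum.distrib)
qed

lemma eigen_sums_sum: "(\<And>i. i \<in> A \<Longrightarrow> g i \<in> eigen_sums) \<Longrightarrow> sum g A \<in> eigen_sums"
  by (induction A rule: infinite_finite_induct) (auto intro: eigen_sums_add eigen_eigen_sums eigen_0)

lemma eigen_sums_mult:
  assumes "g \<in> eigen_sums" "g' \<in> eigen_sums"
  shows "g * g' \<in> eigen_sums"
proof -
  obtain n h n' h' where h: "\<And>d. h d \<in> eigen d" "\<And>d. h' d \<in> eigen d"
    and g: "g = (\<Sum>d\<le>n. h d)" "g' = (\<Sum>d\<le>n'. h' d)"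
    using assms by (auto simp: eigen_sums_def)
  show ?thesis unfolding g sum_product
    by (intro eigen_sums_sum eigen_eigen_sums[OF eigen_mult[OF h]])
qed

lemma eigen_sums_deriv:
  assumes "g \<in> eigen_sums"
  shows "dp_deriv g \<in> eigen_sums"
proof -
  obtain n h where h: "\<And>d. h d \<in> eigen d" and g: "g = (\<Sum>d\<le>n. h d)"
    using assms by (auto simp: eigen_sums_def)
  show ?thesis unfolding g dp_deriv_sum
    by (intro eigen_sums_sum eigen_eigen_sums[OF eigen_deriv[OF h]])
qed

lemma eigen_sums_const: "dp_const r \<in> eigen_sums"
  by (intro eigen_eigen_sums[OF C_eigen] C_const)

lemma eigen_sums_diff: "g \<in> eigen_sums \<Longrightarrow> h \<in> eigen_sums \<Longrightarrow> g - h \<in> eigen_sums"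
  using eigen_sums_add[OF _ eigen_sums_mult[OF eigen_sums_const[of "-1"]], of g h]
  by (simp add: dp_const_uminus)

text \<open>The component in g_0^f has degree 0, the one in [e, g_{-1}] degree 1.\<close>

lemma emb_0_eigen_sums:
  assumes b: "b \<in> G 0"
  shows "em b \<in> eigen_sums"
proof -
  have "em (pr_e b) \<in> eigen 1"
    using V0_emb pr_e_G0[OF b] Euler_pr_e[OF b] by (simp add: eigen_def)
  moreover have "em (b - pr_e b) \<in> eigen 0" by (intro C_eigen emb_Gf_C pr_e_compl b)
  ultimately have "em (b - pr_e b) + em (pr_e b) \<in> eigen_sums"
    by (intro eigen_sums_add) (auto intro: eigen_eigen_sums)
  then show ?thesis by (simp flip: emb_add)
qed

lemma psi_eq_emb_plus:
  "em v = \<psi> v + dp_scale (1/2) (\<Sum>k\<in>J1. em (lie v (u' k)) * em (lie e (u k)))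
     + dp_scale (1/8) (\<Sum>k\<in>J1. em (lie f (u' k)) * em (lie e (circ lie e v (u k))))
     - dp_scale (1/2) (dp_deriv (em (lie e v)))"
  by (simp add: psi_def)

text \<open>Solving the definition of \<psi>(v) for v leaves \<psi>(v), of degree 0, and
  differential polynomials in g_0.\<close>

lemma emb_m1_eigen_sums:
  assumes v: "v \<in> G (-1)"
  shows "em v \<in> eigen_sums"
proof (subst psi_eq_emb_plus)
  have "\<psi> v \<in> eigen_sums" by (intro eigen_eigen_sums[OF C_eigen] psi_C v)
  then show "\<psi> v + dp_scale (1/2) (\<Sum>k\<in>J1. em (lie v (u' k)) * em (lie e (u k)))
     + dp_scale (1/8) (\<Sum>k\<in>J1. em (lie f (u' k)) * em (lie e (circ lie e v (u k))))
     - dp_scale (1/2) (dp_deriv (em (lie e v))) \<in> eigen_sums"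
    unfolding dp_scale_def
    by (intro eigen_sums_add eigen_sums_diff eigen_sums_mult eigen_sums_const eigen_sums_sum
        eigen_sums_deriv emb_0_eigen_sums psi_factors_G0[OF v] G0_lie_1_m1 v e_G)
qed

lemma V0_subset_eigen_sums: "V0 \<subseteq> eigen_sums"
proof
  fix g assume "g \<in> V0"
  then show "g \<in> eigen_sums" unfolding V_le0_def
  proof (induction rule: diff_subalgebra.induct)
    case (gen g)
    then obtain b c where "b \<in> G (-1)" "c \<in> G 0" "g = em b + em c"
      by (auto simp: grade_le0_def emb_add)
    then show ?case by (simp add: eigen_sums_add emb_0_eigen_sums emb_m1_eigen_sums)
  qed (auto intro: eigen_sums_const eigen_sums_add eigen_sums_mult eigen_sums_deriv)
qed

text \<open>\<open>Euler\<close> annihilates W, which forces the components of positive degree to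
  vanish; the one of degree 0 lies in \<open>C\<close> by the choice of
  \<open>eigen\<close>.\<close>

lemma W_subset_C: "W \<subseteq> C"
proof
  fix g assume g: "g \<in> W"
  then have "g \<in> eigen_sums" using V0_subset_eigen_sums by (auto simp: W_iff)
  then obtain n h where h: "\<And>d. h d \<in> eigen d" and gh: "g = (\<Sum>d\<le>n. h d)"
    by (auto simp: eigen_sums_def)
  \<comment> \<open>The sum known to vanish is that of the images \<open>Euler (h d)\<close>, which
    are again eigenvectors; for d > 0 the factor -2d can be cancelled.\<close>
  define v where "v d = dp_scale (-2 * of_nat d) (h d)" for d
  have E: "Euler (h d) = v d" for d using h[of d] by (simp add: eigen_def v_def)
  have "(\<Sum>d\<le>n. v d) = 0" using Euler_W[OF g] by (simp add: gh Euler_sum E)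
  moreover have "Euler (v d) = dp_scale (-2 * of_nat d) (v d)" for d
    by (simp only: v_def[of d] Euler_scale E)
  moreover have "inj (\<lambda>d. -2 * of_nat d :: 'k)" by (simp add: inj_def)
  ultimately have v0: "v d = 0" if "d \<le> n" for d
    using dp.eigenvectors_sum_eq_0[of Euler "\<lambda>d. -2 * of_nat d" n v d] that Euler_add Euler_scale by blast
  have "h d = 0" if "d \<le> n" "d \<noteq> 0" for d
    using v0[OF that(1)] that(2) by (simp add: v_def)
  then have "g = h 0" unfolding gh by (subst sum.remove[of _ 0]) auto
  then show "g \<in> C" using h[of 0] by (simp add: eigen_def)
qed

section \<open>A left inverse of the evaluation at the generators\<close>

definition theta_0 :: "'g \<Rightarrow> 'g" where
  "theta_0 b = (b - lie x (lie x b)) - pr_e (b - lie x (lie x b))"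

text \<open>On the eigenvalues -1, 0, 1 the polynomial 1 - t^2 is 0, 1, 0, so it gives the
  projection to g_0; then 1 - \<open>pr_e\<close> projects g_0 to g_0^f.\<close>

lemma theta_0_Gf: "theta_0 b \<in> Gf"
  unfolding theta_0_def by (rule pr_e_compl) (simp add: mem_G lie_diff_right ad_x_cubed)

lemma theta_0_add: "theta_0 (b + c) = theta_0 b + theta_0 c"
  and theta_0_scale: "theta_0 (scale r b) = scale r (theta_0 b)"
  by (simp_all add: theta_0_def pr_e_def lie_add_right lie_diff_right lie_scale_right algebra_simps
      scale_right_distrib scale_right_diff_distrib)

lemma theta_0_values: "b \<in> Gf \<Longrightarrow> theta_0 b = b" "v \<in> G (-1) \<Longrightarrow> theta_0 v = 0"
    "v \<in> G (-1) \<Longrightarrow> theta_0 (lie e v) = 0"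
  using G0_lie_1_m1[OF _ e_G, of v]
  by (simp_all add: theta_0_def pr_e_def Gf_iff mem_G lie_minus_right lie_f_e[unfolded mem_G] lie_scale_right)

text \<open>Pairing with \<open>u'\<close> reads off the coordinates of the component in g_{-1}. The
  subspaces g_1 and [e, g_{-1}] are sent to 0.\<close>

definition theta :: "'g \<Rightarrow> ('a + 'b, 'k) dpoly" where
  "theta b = (\<Sum>k\<in>J1. dp_const (form b (u' k)) * dp_var (Inr k) 0)
     + (\<Sum>j\<in>J0. dp_const (representation (a ` J0) (theta_0 b) (a j)) * dp_var (Inl j) 0)"

lemma independent_a: "independent (a ` J0)" and span_a: "span (a ` J0) = Gf" and inj_a: "inj_on a J0"
  using a_basis by (simp_all add: basis_family_def)

lemma theta_add: "theta (b + c) = theta b + theta c"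
  and theta_scale: "theta (scale r b) = dp_const r * theta b"
  using theta_0_Gf independent_a span_a
  by (simp_all add: theta_def theta_0_add theta_0_scale form_add_left form_scale_left dp_const_add
      dp_const_mult representation_add representation_scale distrib_left distrib_right sum.distrib
      sum_distrib_left mult.assoc)

lemma theta_a:
  assumes "j \<in> J0"
  shows "theta (a j) = dp_var (Inl j) 0"
proof -
  have a: "a j \<in> Gf" by (rule a_Gf[OF assms])
  have "form (a j) (u' k) = 0" if "k \<in> J1" for k
    using form_G_eq_0[of "a j" 0 "u' k" 1] a u'_G[OF that] by (simp add: Gf_iff)
  moreover have "dp_const (representation (a ` J0) (a j) (a i)) * dp_var (Inl i) 0
      = (if i = j then dp_var (Inl j) 0 else 0 :: ('a + 'b, 'k) dpoly)" if "i \<in> J0" for i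
    using that assms inj_a by (auto simp: representation_basis[OF independent_a] inj_on_def)
  ultimately show ?thesis using assms finite_J0 by (simp add: theta_def theta_0_values(1)[OF a])
qed

lemma theta_u:
  assumes "j \<in> J1"
  shows "theta (u j) = dp_var (Inr j) 0"
proof -
  have "dp_const (form (u j) (u' k)) * dp_var (Inr k) 0
      = (if k = j then dp_var (Inr j) 0 else 0 :: ('a + 'b, 'k) dpoly)" if "k \<in> J1" for k
    using that assms dual by auto
  then show ?thesis using assms finite_J1
    by (simp add: theta_def theta_0_values(2)[OF u_G[OF assms]] representation_zero)
qed

lemma theta_lie_e:
  assumes v: "v \<in> G (-1)"
  shows "theta (lie e v) = 0"
proof -
  have "form (lie e v) (u' k) = 0" if "k \<in> J1" for k
    using form_G_eq_0[OF G0_lie_1_m1[OF v e_G] u'_G[OF that]] by simp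
  then show ?thesis by (simp add: theta_def theta_0_values(3)[OF v] representation_zero)
qed

text \<open>Every correction term of \<open>\<psi>(u\<^sub>k)\<close> has a factor in \<open>[e, g\<^sub>-\<^sub>1]\<close>, which \<open>theta\<close> kills;
  hence it extends to a left inverse of the evaluation at the generators.\<close>

lemma theta_left_inverse:
  assumes "p \<in> dpolys JJ"
  shows "dp_eval (\<lambda>i. theta (bas i)) (dp_eval gens p) = p"
proof -
  let ?\<Theta> = "dp_eval (\<lambda>i. theta (bas i))"
  have em: "?\<Theta> (em b) = theta b" for b by (rule dp_eval_emb[OF theta_add theta_scale])
  have psi: "?\<Theta> (\<psi> (u k)) = dp_var (Inr k) 0" if "k \<in> J1" for k
    by (simp add: psi_def dp_scale_def dp_eval_add dp_eval_diff dp_eval_sum dp_eval_mult dp_eval_deriv em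
        theta_lie_e circ_G u_G theta_u that)
  have gens: "?\<Theta> (gens j) = dp_var j 0" if "j \<in> JJ" for j
    using that by (auto simp: em theta_a psi)
  have iter: "?\<Theta> ((dp_deriv ^^ m) q) = (dp_deriv ^^ m) (?\<Theta> q)" for m q
    by (induction m) (simp_all add: dp_eval_deriv)
  show ?thesis using assms
    by (induction rule: dpolys_induct)
      (simp_all add: dp_eval_add dp_eval_mult dp_eval_var iter gens dp_deriv_iter_var)
qed

lemma diff_poly_algebra: "is_diff_poly_algebra_on JJ gens W"
  unfolding is_diff_poly_algebra_on_def bij_betw_def
proof
  show "inj_on (dp_eval gens) (dpolys JJ)" by (rule inj_on_inverseI) (rule theta_left_inverse)
  show "C = W" using C_subset_W W_subset_C by blast
qed

section \<open>Conformal weights one and two\<close>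

text \<open>The coefficients of the degree 1 monomials in m-th derivatives, reassembled into an
  element of g. It recovers v from \<psi>(v) and separates the summands in weight 2.\<close>

definition lin_part :: "nat \<Rightarrow> ('i, 'k) dpoly \<Rightarrow> 'g" where
  "lin_part m p = (\<Sum>i\<in>UNIV. scale (Poly_Mapping.lookup p (Poly_Mapping.single (i, m) 1)) (bas i))"

lemma lin_part_add: "lin_part m (p + q) = lin_part m p + lin_part m q"
  and lin_part_const_mult: "lin_part m (dp_const r * p) = scale r (lin_part m p)"
  by (simp_all add: lin_part_def lookup_add scale_left_distrib sum.distrib lookup_const_mult scale_sum_right)

lemma lin_part_0 [simp]: "lin_part m 0 = 0"
  by (simp add: lin_part_def)

lemma lin_part_diff: "lin_part m (p - q) = lin_part m p - lin_part m q"
  using lin_part_add[of m "p - q" q] by simp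

lemma lin_part_sum: "lin_part m (sum g A) = (\<Sum>i\<in>A. lin_part m (g i))"
  by (induction A rule: infinite_finite_induct) (simp_all add: lin_part_add)

lemma lin_part_var: "lin_part m (dp_var i n) = (if m = n then bas i else 0)"
proof -
  have "Poly_Mapping.single (i, n) 1 = Poly_Mapping.single (j, m) (1::nat) \<longleftrightarrow> i = j \<and> n = m" for j
    by (metis keys_single one_neq_zero prod.inject singleton_inject)
  then show ?thesis
    by (simp add: lin_part_def dp_var_def lookup_single when_def if_distrib[of "\<lambda>c. scale c _"] cong: if_cong)
qed

lemma lin_part_var_mult: "lin_part m (dp_var i n * dp_var j n') = 0"
proof -
  have "Poly_Mapping.single (i, n) 1 + Poly_Mapping.single (j, n') 1 \<noteq> Poly_Mapping.single (k, m) (1::nat)" for k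
  proof
    assume eq: "Poly_Mapping.single (i, n) 1 + Poly_Mapping.single (j, n') 1 = Poly_Mapping.single (k, m) (1::nat)"
    \<comment> \<open>Comparing exponents at the two variables shows that both are (k, m), and then
      the exponent on the left is 2.\<close>
    show False
      using arg_cong[OF eq, of "\<lambda>t. Poly_Mapping.lookup t (i, n)"] arg_cong[OF eq, of "\<lambda>t. Poly_Mapping.lookup t (j, n')"]
      by (auto simp: lookup_add lookup_single when_def split: if_splits)
  qed
  then show ?thesis
    by (simp add: lin_part_def dp_var_def mult_single lookup_single when_def)
qed

lemma lin_part_emb: "lin_part m (em b) = (if m = 0 then b else 0)"
  by (simp add: emb_def dp_scale_def lin_part_sum lin_part_const_mult lin_part_var representation_sum_bas)

lemma lin_part_deriv_emb: "lin_part m (dp_deriv (em b)) = (if m = 1 then b else 0)"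
  by (simp add: emb_def dp_scale_def dp_deriv_sum dp_deriv_const_mult dp_deriv_var lin_part_sum
      lin_part_const_mult lin_part_var representation_sum_bas)

lemma lin_part_emb_mult: "lin_part m (em b * em c) = 0"
proof -
  have "em b * em c = (\<Sum>i\<in>UNIV. \<Sum>j\<in>UNIV. dp_const (representation (range bas) b (bas i)) *
      (dp_const (representation (range bas) c (bas j)) * (dp_var i 0 * dp_var j 0)))"
    by (simp add: emb_def dp_scale_def sum_product mult_ac)
  then show ?thesis by (simp add: lin_part_sum lin_part_const_mult lin_part_var_mult)
qed

text \<open>The corrections in \<psi>(v) are quadratic or first derivatives, so they have no linear
  part of order 0.\<close>

lemma lin_part_psi: "lin_part 0 (\<psi> v) = v"
  by (simp add: psi_def dp_scale_def lin_part_add lin_part_diff lin_part_sum lin_part_const_mult lin_part_emb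
      lin_part_emb_mult lin_part_deriv_emb)

lemma lin_part_sym2: "q \<in> sym2 scale bas U \<Longrightarrow> lin_part m q = 0"
  unfolding sym2_def
  by (induction rule: dp.span_induct_alt)
    (auto simp: lin_part_add dp_scale_def lin_part_const_mult lin_part_emb_mult)


section \<open>Differential polynomials of conformal weight 1 and 2\<close>

lemma V_weight_factors:
  "b \<in> G 0 \<Longrightarrow> em b \<in> V_weight scale lie bas x 1"
  "b \<in> G (-1) \<Longrightarrow> em b \<in> V_weight scale lie bas x 2"
  "b \<in> G 0 \<Longrightarrow> dp_deriv (em b) \<in> V_weight scale lie bas x 2"
  "b \<in> G 0 \<Longrightarrow> c \<in> G 0 \<Longrightarrow> em b * em c \<in> V_weight scale lie bas x 2"
  unfolding V_weight_def
  by (rule dp.span_base, rule CollectI, rule exI[of _ "[(b, 1, 0)]"], simp)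
    (rule dp.span_base, rule CollectI, rule exI[of _ "[(b, 2, 0)]"], simp,
     rule dp.span_base, rule CollectI, rule exI[of _ "[(b, 1, 1)]"], simp,
     rule dp.span_base, rule CollectI, rule exI[of _ "[(b, 1, 0), (c, 1, 0)]"], simp)

lemma subspace_V_weight: "dp.subspace (V_weight scale lie bas x n)"
  by (simp add: V_weight_def dp.subspace_span)

lemma subspace_sym2: "dp.subspace (sym2 scale bas U)"
  by (simp add: sym2_def dp.subspace_span)

lemma sym2_emb: "b \<in> U \<Longrightarrow> c \<in> U \<Longrightarrow> em b * em c \<in> sym2 scale bas U"
  unfolding sym2_def by (rule dp.span_base) auto

lemma sym2_subset: "dp.subspace S \<Longrightarrow> (\<And>b c. b \<in> U \<Longrightarrow> c \<in> U \<Longrightarrow> em b * em c \<in> S) \<Longrightarrow> sym2 scale bas U \<subseteq> S"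
  unfolding sym2_def by (rule dp.span_minimal) auto

lemma subspace_W: "dp.subspace W"
  using W_const[of 0] by (intro dp.subspaceI) (auto simp: dp_scale_def intro: W_add W_mult W_const)

text \<open>Every factor has weight at least 1, so total weight at most 2 leaves at most two
  factors. \<open>P\<close> stands for the condition on the degree of \<open>b\<close>.\<close>

lemma sum_list_positive_cases:
  assumes "\<forall>(b, d, m)\<in>set l. d \<in> {1, 2 :: nat} \<and> P b d" "sum_list (map (\<lambda>(b, d, m). d + m) l) = n" "n \<in> {1, 2}"
  shows "n = 1 \<and> (\<exists>b. l = [(b, 1, 0)]) \<or> n = 2 \<and>
    ((\<exists>b. l = [(b, 2, 0)]) \<or> (\<exists>b. l = [(b, 1, 1)]) \<or> (\<exists>b c. l = [(b, 1, 0), (c, 1, 0)]))"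
proof -
  consider "l = []" | b d m where "l = [(b, d, m)]" | b d m b' d' m' l' where "l = (b, d, m) # (b', d', m') # l'"
    by (metis list.exhaust prod_cases3)
  then show ?thesis
  proof cases
    case 3
    \<comment> \<open>A third factor would raise the weight to at least 3.\<close>
    have "l' = []"
    proof (cases l')
      case (Cons y l'')
      obtain b'' d'' m'' where "y = (b'', d'', m'')" by (rule prod_cases3)
      then show ?thesis using assms 3 Cons by auto
    qed
    then show ?thesis using assms 3 by auto
  qed (use assms in auto)
qed

lemma V_weight_1: "V_weight scale lie bas x 1 \<subseteq> em ` G 0"
  unfolding V_weight_def
proof (rule dp.span_minimal)
  show "dp.subspace (em ` G 0)"
  proof (rule dp.subspaceI)
    show "0 \<in> em ` G 0" by (rule image_eqI[of _ _ 0]) (simp_all add: subspace_0[OF subspace_G])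
  next
    fix p q assume "p \<in> em ` G 0" "q \<in> em ` G 0"
    then show "p + q \<in> em ` G 0" by (auto simp flip: emb_add intro!: imageI subspace_add[OF subspace_G])
  next
    fix r p assume "p \<in> em ` G 0"
    then show "dp_scale r p \<in> em ` G 0"
      by (auto simp: dp_scale_def simp flip: emb_scale intro!: imageI subspace_scale[OF subspace_G])
  qed
  show "{prod_list (map (\<lambda>(b, d, m). (dp_deriv ^^ m) (em b)) l) |l.
        (\<forall>(b, d, m)\<in>set l. d \<in> {1, 2} \<and> b \<in> G (1 - int d)) \<and>
        sum_list (map (\<lambda>(b, d, m). d + m) l) = 1} \<subseteq> em ` G 0"
  proof safe
    fix l :: "('g \<times> nat \<times> nat) list"
    assume l: "\<forall>(b, d, m)\<in>set l. d \<in> {1, 2} \<and> b \<in> G (1 - int d)" "sum_list (map (\<lambda>(b, d, m). d + m) l) = 1"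
    obtain b where "l = [(b, 1, 0)]" using sum_list_positive_cases[OF l] by auto
    then show "prod_list (map (\<lambda>(b, d, m). (dp_deriv ^^ m) (em b)) l) \<in> em ` G 0" using l by simp
  qed
qed

text \<open>The right-hand side is a subspace containing each spanning monomial: a vector of g_{-1},
  a first derivative from g_0, or a product of two elements of g_0.\<close>

lemma V_weight_2:
  "V_weight scale lie bas x 2 \<subseteq>
    {em b + dp_deriv (em c) + q | b c q. b \<in> G (-1) \<and> c \<in> G 0 \<and> q \<in> sym2 scale bas (G 0)}" (is "_ \<subseteq> ?S")
  unfolding V_weight_def
proof (rule dp.span_minimal)
  have I: "em b + dp_deriv (em c) + q \<in> ?S" if "b \<in> G (-1)" "c \<in> G 0" "q \<in> sym2 scale bas (G 0)" for b c q
    using that by blast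
  have G0: "0 \<in> G i" for i by (rule subspace_0[OF subspace_G])
  have sym0: "0 \<in> sym2 scale bas (G 0)" by (rule dp.subspace_0[OF subspace_sym2])
  show "dp.subspace ?S"
  proof (rule dp.subspaceI)
    show "0 \<in> ?S" using I[OF G0 G0 sym0] by simp
  next
    fix p p' assume "p \<in> ?S" "p' \<in> ?S"
    then obtain b c q b' c' q' where *: "p = em b + dp_deriv (em c) + q" "p' = em b' + dp_deriv (em c') + q'"
      "b \<in> G (-1)" "c \<in> G 0" "q \<in> sym2 scale bas (G 0)" "b' \<in> G (-1)" "c' \<in> G 0" "q' \<in> sym2 scale bas (G 0)"
      by blast
    have eq: "p + p' = em (b + b') + dp_deriv (em (c + c')) + (q + q')"
      by (simp add: * emb_add dp_deriv_add)
    show "p + p' \<in> ?S" unfolding eq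
      by (intro I subspace_add[OF subspace_G] dp.subspace_add[OF subspace_sym2] *)
  next
    fix r p assume "p \<in> ?S"
    then obtain b c q where *: "p = em b + dp_deriv (em c) + q" "b \<in> G (-1)" "c \<in> G 0" "q \<in> sym2 scale bas (G 0)"
      by blast
    have eq: "dp_scale r p = em (scale r b) + dp_deriv (em (scale r c)) + dp_scale r q"
      by (simp add: * emb_scale dp_scale_def dp_deriv_const_mult distrib_left)
    show "dp_scale r p \<in> ?S" unfolding eq
      by (intro I subspace_scale[OF subspace_G] dp.subspace_scale[OF subspace_sym2] *)
  qed
  show "{prod_list (map (\<lambda>(b, d, m). (dp_deriv ^^ m) (em b)) l) |l.
        (\<forall>(b, d, m)\<in>set l. d \<in> {1, 2} \<and> b \<in> G (1 - int d)) \<and>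
        sum_list (map (\<lambda>(b, d, m). d + m) l) = 2} \<subseteq> ?S"
  proof (intro subsetI)
    fix p assume "p \<in> {prod_list (map (\<lambda>(b, d, m). (dp_deriv ^^ m) (em b)) l) |l.
        (\<forall>(b, d, m)\<in>set l. d \<in> {1, 2} \<and> b \<in> G (1 - int d)) \<and>
        sum_list (map (\<lambda>(b, d, m). d + m) l) = 2}"
    then obtain l where p: "p = prod_list (map (\<lambda>(b, d, m). (dp_deriv ^^ m) (em b)) l)"
      and l: "\<forall>(b, d, m)\<in>set l. d \<in> {1, 2} \<and> b \<in> G (1 - int d)" "sum_list (map (\<lambda>(b, d, m). d + m) l) = 2"
      by blast
    consider b where "l = [(b, 2, 0)]" | b where "l = [(b, 1, 1)]" | b c where "l = [(b, 1, 0), (c, 1, 0)]"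
      using sum_list_positive_cases[OF l] by auto
    then show "p \<in> ?S"
    proof cases
      case (1 b)
      then show ?thesis using I[OF _ G0 sym0, of b] l p by simp
    next
      case (2 b)
      then show ?thesis using I[OF G0 _ sym0, of b] l p by simp
    next
      case (3 b c)
      then show ?thesis using I[OF G0 G0, of "em b * em c"] sym2_emb[of b "G 0" c] l p by simp
    qed
  qed
qed

section \<open>The spaces W{1} and W{2}\<close>

abbreviation "W_part \<equiv> W_weight scale lie form bas x f br"

lemma psi_W_part_2:
  assumes v: "v \<in> G (-1)"
  shows "\<psi> v \<in> W_part 2"
proof -
  have "\<psi> v \<in> V_weight scale lie bas x 2"
    unfolding psi_def
    by (intro dp.subspace_add dp.subspace_diff dp.subspace_scale dp.subspace_sum subspace_V_weight
        V_weight_factors v psi_factors_G0[OF v] G0_lie_1_m1 e_G)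
  then show ?thesis by (simp add: W_weight_def psi_W v)
qed

text \<open>In weight 1 only g_0 occurs, and there the conditions defining W say that [b, f] pairs
  to zero with g_1.\<close>

lemma W_part_1: "W_part 1 = em ` Gf"
proof
  show "W_part 1 \<subseteq> em ` Gf"
  proof
    fix g assume "g \<in> W_part 1"
    then obtain b where b: "b \<in> G 0" "g = em b" and "g \<in> W" using V_weight_1 by (auto simp: W_weight_def)
    then have "form c (lie b f) = 0" if "c \<in> G 1" for c
      using that Dr_emb_0[OF that b(1)] by (simp add: W_iff)
    then show "g \<in> em ` Gf" using b Gf_of_form_eq_0 by blast
  qed
  show "em ` Gf \<subseteq> W_part 1"
    using emb_Gf_W V_weight_factors(1) by (auto simp: W_weight_def Gf_iff)
qed

text \<open>Splitting both factors by \<open>pr_e\<close> sorts a product by its degree 0, 1 or 2 in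
  [e, g_{-1}], with \<open>Euler\<close> eigenvalues 0, -2, -4.\<close>

lemma sym2_decompose:
  assumes "q \<in> sym2 scale bas (G 0)"
  obtains q0 q1 q2 where "q = q0 + q1 + q2" "q0 \<in> sym2 scale bas Gf"
    "Euler q1 = dp_scale (-2) q1" "Euler q2 = dp_scale (-4) q2"
proof -
  define S where "S = {q0 + q1 + q2 | q0 q1 q2. q0 \<in> sym2 scale bas Gf \<and>
    Euler q1 = dp_scale (-2) q1 \<and> Euler q2 = dp_scale (-4) q2}"
  have I: "q0 + q1 + q2 \<in> S"
    if "q0 \<in> sym2 scale bas Gf" "Euler q1 = dp_scale (-2) q1" "Euler q2 = dp_scale (-4) q2" for q0 q1 q2
    using that unfolding S_def by blast
  have "dp.subspace S"
  proof (rule dp.subspaceI)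
    show "0 \<in> S" using I[of 0 0 0] dp.subspace_0[OF subspace_sym2] by simp
  next
    fix p p' assume "p \<in> S" "p' \<in> S"
    then obtain q0 q1 q2 q0' q1' q2' where *: "p = q0 + q1 + q2" "p' = q0' + q1' + q2'"
      "q0 \<in> sym2 scale bas Gf" "Euler q1 = dp_scale (-2) q1" "Euler q2 = dp_scale (-4) q2"
      "q0' \<in> sym2 scale bas Gf" "Euler q1' = dp_scale (-2) q1'" "Euler q2' = dp_scale (-4) q2'"
      unfolding S_def by blast
    have eq: "p + p' = (q0 + q0') + (q1 + q1') + (q2 + q2')" by (simp add: *(1,2))
    show "p + p' \<in> S" unfolding eq
      by (intro I dp.subspace_add[OF subspace_sym2] *)
        (simp_all add: *(4,5,7,8) Euler_add dp.scale_right_distrib)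
  next
    fix r p assume "p \<in> S"
    then obtain q0 q1 q2 where *: "p = q0 + q1 + q2"
      "q0 \<in> sym2 scale bas Gf" "Euler q1 = dp_scale (-2) q1" "Euler q2 = dp_scale (-4) q2"
      unfolding S_def by blast
    have eq: "dp_scale r p = dp_scale r q0 + dp_scale r q1 + dp_scale r q2"
      by (simp add: *(1) dp.scale_right_distrib)
    show "dp_scale r p \<in> S" unfolding eq
      by (intro I dp.subspace_scale[OF subspace_sym2] *) (simp_all add: *(3,4) Euler_scale mult.commute)
  qed
  moreover have "em b * em c \<in> S" if b: "b \<in> G 0" and c: "c \<in> G 0" for b c
  proof -
    let ?b0 = "em (b - pr_e b)" and ?b1 = "em (pr_e b)" and ?c0 = "em (c - pr_e c)" and ?c1 = "em (pr_e c)"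
    have V0: "?b0 \<in> V0" "?b1 \<in> V0" "?c0 \<in> V0" "?c1 \<in> V0"
      using b c by (auto intro!: V0_emb pr_e_G0 subspace_diff[OF subspace_G])
    have E0: "Euler ?b0 = dp_scale 0 ?b0" "Euler ?c0 = dp_scale 0 ?c0"
      using Euler_W[OF emb_Gf_W] pr_e_compl b c by simp_all
    have "Euler (?b0 * ?c1) = dp_scale (0 + -2) (?b0 * ?c1)" "Euler (?b1 * ?c0) = dp_scale (-2 + 0) (?b1 * ?c0)"
      "Euler (?b1 * ?c1) = dp_scale (-2 + -2) (?b1 * ?c1)"
      by (rule Euler_eigen_mult; fact V0 E0 Euler_pr_e[OF b] Euler_pr_e[OF c])+
    then have "?b0 * ?c0 + (?b0 * ?c1 + ?b1 * ?c0) + ?b1 * ?c1 \<in> S"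
      using b c by (intro I sym2_emb pr_e_compl) (simp_all add: Euler_add dp.scale_right_distrib)
    also have "?b0 * ?c0 + (?b0 * ?c1 + ?b1 * ?c0) + ?b1 * ?c1 = em b * em c"
      by (simp add: emb_diff algebra_simps)
    finally show ?thesis .
  qed
  ultimately have "q \<in> S" using assms sym2_subset[of S "G 0"] by blast
  then show ?thesis using that unfolding S_def by blast
qed

text \<open>\<open>Euler\<close> annihilates W, so its values on the components of degree 1 and 2
  cancel; the eigenvalues are distinct and nonzero, hence both components vanish.\<close>

lemma sym2_W:
  assumes "q \<in> sym2 scale bas (G 0)" "q \<in> W"
  shows "q \<in> sym2 scale bas Gf"
proof -
  obtain q0 q1 q2 where q: "q = q0 + q1 + q2" and q0: "q0 \<in> sym2 scale bas Gf"
    and E: "Euler q1 = dp_scale (-2) q1" "Euler q2 = dp_scale (-4) q2"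
    using sym2_decompose[OF assms(1)] by metis
  have "sym2 scale bas Gf \<subseteq> W" by (intro sym2_subset subspace_W W_mult emb_Gf_W)
  then have "Euler q0 = 0" using q0 Euler_W by blast
  then have E1: "dp_scale (-2) q1 + dp_scale (-4) q2 = 0"
    using Euler_W[OF assms(2)] by (simp add: q Euler_add E)
  \<comment> \<open>A second application of \<open>Euler\<close> gives a relation between
    \<open>q1\<close> and \<open>q2\<close> that is independent of the first one.\<close>
  have "Euler (dp_scale (-2) q1 + dp_scale (-4) q2) = dp_scale 4 q1 + dp_scale 16 q2"
    by (simp only: Euler_add Euler_scale E dp.scale_scale) simp
  then have "dp_scale 4 q1 + dp_scale 16 q2 = 0" by (simp only: E1 Euler_0)
  moreover have "dp_scale 4 q1 + dp_scale 8 q2 = dp_scale (-2) (dp_scale (-2) q1 + dp_scale (-4) q2)"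
    by (simp only: dp.scale_right_distrib dp.scale_scale) simp
  then have "dp_scale 4 q1 + dp_scale 8 q2 = 0" by (simp only: E1 dp.scale_zero_right)
  moreover have "dp_scale 8 q2 = (dp_scale 4 q1 + dp_scale 16 q2) - (dp_scale 4 q1 + dp_scale 8 q2)"
    by (simp only: add_diff_cancel_left dp.scale_left_diff_distrib[symmetric]) simp
  ultimately have "dp_scale 8 q2 = 0" by (simp only: diff_self)
  then have "q2 = 0" by simp
  moreover from this have "q1 = 0" using E1 by simp
  ultimately show ?thesis using q q0 by simp
qed

text \<open>On g_0 the values of \<open>Dr\<close> are constants free of \<lambda>, so the Leibniz
  rule produces no \<lambda> on products. This isolates the contribution of derivatives in weight
  2.\<close>

lemma Dr_sym2:
  assumes "q \<in> sym2 scale bas (G 0)" and c: "c \<in> G 1"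
  shows "coeff (Dr c q) 1 = 0"
proof -
  have "dp.subspace {q. coeff (Dr c q) 1 = 0}"
    by (rule dp.subspaceI) (simp_all add: Dr_add dp_scale_def Dr_const_mult)
  moreover have "coeff (Dr c (em b * em b')) 1 = 0" if "b \<in> G 0" "b' \<in> G 0" for b b'
    by (simp add: Dr_emb_emb_0 c that)
  ultimately show ?thesis using assms sym2_subset[of "{q. coeff (Dr c q) 1 = 0}" "G 0"] by blast
qed

text \<open>Subtracting \<psi>(v) removes the component in g_{-1} without leaving W; the
  \<lambda>-coefficient then puts \<open>h\<close> into g_0^f, and subtracting \<partial>h leaves a
  quadratic element of W.\<close>

lemma W_part_2_subset:
  assumes "g \<in> W_part 2"
  obtains v h q where "v \<in> G (-1)" "h \<in> Gf" "q \<in> sym2 scale bas Gf" "g = \<psi> v + dp_deriv (em h) + q"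
proof -
  obtain v c q where v: "v \<in> G (-1)" and c: "c \<in> G 0" and q: "q \<in> sym2 scale bas (G 0)"
    and g: "g = em v + dp_deriv (em c) + q" and gW: "g \<in> W"
    using assms V_weight_2 by (auto simp: W_weight_def)
  \<comment> \<open>Passing from v to \<psi>(v) costs the corrections of \<psi>: the derivative term
    is absorbed by \<open>h\<close>, the quadratic ones by \<open>q'\<close>.\<close>
  define h where "h = c - scale (1/2) (lie e v)"
  define q' where "q' = q + dp_scale (1/2) (\<Sum>k\<in>J1. em (lie v (u' k)) * em (lie e (u k)))
     + dp_scale (1/8) (\<Sum>k\<in>J1. em (lie f (u' k)) * em (lie e (circ lie e v (u k))))"
  have h: "h \<in> G 0" unfolding h_def
    by (intro subspace_diff[OF subspace_G] subspace_scale[OF subspace_G] c G0_lie_1_m1 v e_G)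
  have q': "q' \<in> sym2 scale bas (G 0)" unfolding q'_def
    by (intro dp.subspace_add dp.subspace_scale dp.subspace_sum subspace_sym2 q sym2_emb psi_factors_G0[OF v])
  have g': "g = \<psi> v + dp_deriv (em h) + q'"
    unfolding g psi_def q'_def h_def emb_diff emb_scale
    by (simp add: dp_deriv_diff dp_scale_def dp_deriv_const_mult)
  have "dp_deriv (em h) + q' = g - \<psi> v" by (simp add: g')
  then have W: "dp_deriv (em h) + q' \<in> W" using W_diff[OF gW psi_W[OF v]] by simp
  have "h \<in> Gf"
  proof (rule Gf_of_form_eq_0[OF h])
    fix b assume b: "b \<in> G 1"
    have "Dr b (dp_deriv (em h) + q') = 0" using W b by (simp add: W_iff)
    \<comment> \<open>Only \<partial>h contributes to the coefficient of \<lambda>, and its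
      contribution is (b | [h, f]).\<close>
    then have "coeff (lam_deriv (Dr b (em h))) 1 + coeff (Dr b q') 1 = 0"
      by (simp only: Dr_add Dr_deriv coeff_add[symmetric] coeff_0)
    then show "form b (lie h f) = 0" by (simp add: Dr_sym2[OF q' b, simplified] Dr_emb_0 b h lam_deriv_constant)
  qed
  moreover from this have "q' \<in> W"
    using W_diff[OF W W_deriv[OF emb_Gf_W[of h]]] by simp
  then have "q' \<in> sym2 scale bas Gf" by (rule sym2_W[OF q'])
  ultimately show ?thesis using that v g' by blast
qed

lemma W_part_2: "is_direct_sum3 (W_part 2) (\<psi> ` G (-1)) (dp_deriv ` em ` Gf) (sym2 scale bas Gf)"
  unfolding is_direct_sum3_def
proof
  have sub: "dp.subspace (W_part 2)" unfolding W_weight_def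
    by (intro dp.subspace_inter subspace_W subspace_V_weight)
  have "dp_deriv (em h) \<in> W_part 2" if "h \<in> Gf" for h
    using that V_weight_factors(3) W_deriv[OF emb_Gf_W[OF that]] by (simp add: W_weight_def Gf_iff)
  moreover have "sym2 scale bas Gf \<subseteq> W_part 2"
    using V_weight_factors(4)
    by (intro sym2_subset[OF sub]) (simp add: W_weight_def W_mult emb_Gf_W, simp add: Gf_iff)
  ultimately have "{p + q + r |p q r. p \<in> \<psi> ` G (-1) \<and> q \<in> dp_deriv ` em ` Gf \<and> r \<in> sym2 scale bas Gf} \<subseteq> W_part 2"
    using psi_W_part_2 by (auto intro!: dp.subspace_add[OF sub])
  moreover have "W_part 2 \<subseteq> {p + q + r |p q r. p \<in> \<psi> ` G (-1) \<and> q \<in> dp_deriv ` em ` Gf \<and> r \<in> sym2 scale bas Gf}"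
  proof
    fix g assume "g \<in> W_part 2"
    then obtain v h q where "v \<in> G (-1)" "h \<in> Gf" "q \<in> sym2 scale bas Gf" "g = \<psi> v + dp_deriv (em h) + q"
      by (rule W_part_2_subset)
    then show "g \<in> {p + q + r |p q r. p \<in> \<psi> ` G (-1) \<and> q \<in> dp_deriv ` em ` Gf \<and> r \<in> sym2 scale bas Gf}"
      by blast
  qed
  ultimately show "W_part 2 = {p + q + r |p q r. p \<in> \<psi> ` G (-1) \<and> q \<in> dp_deriv ` em ` Gf \<and> r \<in> sym2 scale bas Gf}"
    by blast
  show "\<forall>p\<in>\<psi> ` G (-1). \<forall>q\<in>dp_deriv ` em ` Gf. \<forall>r\<in>sym2 scale bas Gf. p + q + r = 0 \<longrightarrow> p = 0 \<and> q = 0 \<and> r = 0"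
  proof (intro ballI impI)
    fix p q r assume "p \<in> \<psi> ` G (-1)" "q \<in> dp_deriv ` em ` Gf" and r: "r \<in> sym2 scale bas Gf" and 0: "p + q + r = 0"
    then obtain v h where p: "p = \<psi> v" and q: "q = dp_deriv (em h)" by blast
    \<comment> \<open>The linear part of order 0 recovers v; once v = 0, that of order 1 recovers
      h.\<close>
    have "lin_part m (\<psi> v) + (if m = 1 then h else 0) = 0" for m
      using arg_cong[OF 0, of "lin_part m"] by (simp add: lin_part_add p q lin_part_deriv_emb lin_part_sym2[OF r])
    from this[of 0] this[of 1] have "v = 0" and "lin_part 1 (\<psi> v) + h = 0" by (simp_all add: lin_part_psi)
    then have "v = 0" "h = 0" by (simp_all add: psi_0)
    then show "p = 0 \<and> q = 0 \<and> r = 0" using 0 p q by (simp add: psi_0)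
  qed
qed

lemma inj_on_psi: "inj_on \<psi> S"
  by (rule inj_on_inverseI[of _ "lin_part 0"]) (rule lin_part_psi)

end

theorem theorem5p2:
  fixes scale :: "'k::{alg_closed_field, field_char_0} \<Rightarrow> 'g::ab_group_add \<Rightarrow> 'g"
    and lie :: "'g \<Rightarrow> 'g \<Rightarrow> 'g"
    and form :: "'g \<Rightarrow> 'g \<Rightarrow> 'k"
    and bas :: "'i::finite \<Rightarrow> 'g"
    and e x f s :: 'g
    and z :: 'k
    and br :: "('i, 'k) dpoly \<Rightarrow> ('i, 'k) dpoly \<Rightarrow> ('i, 'k) dpoly poly"
    and J0 :: "'a set" and a :: "'a \<Rightarrow> 'g"
    and J1 :: "'b set" and u u' :: "'b \<Rightarrow> 'g"
  assumes "lie_algebra scale lie"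
    and "basis_family scale UNIV bas UNIV"
    and "is_simple_lie scale lie"
    and "nondeg_invariant_form scale lie form"
    and "sl2_triple scale lie f x e"
    and "short_grading scale lie x"
    and "s \<in> grade scale lie x 1"
    and "affine_lambda_bracket scale lie form bas s z br"
    and "basis_family scale J0 a (centralizer0 scale lie x f)"
    and "basis_family scale J1 u (grade scale lie x (-1))"
    and "basis_family scale J1 u' (grade scale lie x 1)"
    and "\<forall>j\<in>J1. \<forall>k\<in>J1. form (u j) (u' k) = (if j = k then 1 else 0)"
  shows "is_diff_poly_algebra_on (J0 <+> J1)
           (case_sum (\<lambda>i. emb scale bas (a i)) (\<lambda>k. psi scale lie bas e f J1 u u' (u k)))
           (W_alg scale lie form bas x f br) \<and>
         psi scale lie bas e f J1 u u' ` grade scale lie x (-1)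
           \<subseteq> W_weight scale lie form bas x f br 2 \<and>
         inj_on (psi scale lie bas e f J1 u u') (grade scale lie x (-1)) \<and>
         (\<forall>v\<in>grade scale lie x (-1). \<forall>w\<in>grade scale lie x (-1).
            psi scale lie bas e f J1 u u' (v + w)
              = psi scale lie bas e f J1 u u' v + psi scale lie bas e f J1 u u' w) \<and>
         (\<forall>c. \<forall>v\<in>grade scale lie x (-1).
            psi scale lie bas e f J1 u u' (scale c v)
              = dp_scale c (psi scale lie bas e f J1 u u' v)) \<and>
         W_weight scale lie form bas x f br 1 = emb scale bas ` centralizer0 scale lie x f \<and>
         is_direct_sum3 (W_weight scale lie form bas x f br 2)
           (psi scale lie bas e f J1 u u' ` grade scale lie x (-1))
           (dp_deriv ` emb scale bas ` centralizer0 scale lie x f)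
           (sym2 scale bas (centralizer0 scale lie x f))"
proof -
  interpret short_W_algebra scale lie form bas e x f s z br J0 a J1 u u'
    by (intro short_W_algebra.intro short_W_algebra_axioms.intro assms)
  show ?thesis
    using diff_poly_algebra psi_W_part_2 inj_on_psi psi_add psi_scale W_part_1 W_part_2
    by (auto simp: dp_scale_def)
qed

end
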